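(* Let $\mathcal X$ be an antisymmetric cyclotomic scheme over a finite field. Then $gb(\mathcal X)\le 1$ and $b(\mathcal X)\le 3$.
   Context: A coherent configuration on a finite set $\Omega$ is a pair $\mathcal X=(\Omega,S)$ where $S$ is a partition of $\Omega\times\Omega$ such that $1_\Omega$ is a union of elements of $S$, $s^*=\{(\beta,\alpha):(\alpha,\beta)\in s\}\in S$ for $s\in S$, and for $r,s,t\in S$ the number $|\{\gamma:(\alpha,\gamma)\in r,(\gamma,\beta)\in s\}|$ is independent of $(\alpha,\beta)\in t$; fibers are sets $\Gamma$ with $1_\Gamma\in S$. It is antisymmetric if every $s\in S$ with $s=s^*$ lies in $1_\Omega$. A fission is a finer coherent configuration (its relation set, i.e. unions of basic relations, contains that of $\mathcal X$); complete means all basic relations are singletons. For $\Pi\subseteq 2^\Omega$ the $\Pi$-fission is the smallest fission in which every member of $\Pi$ is a union of fibers; $\Pi$ is a generalized base if the $\Pi$-fission is complete, and a set $B\subseteq\Omega$ is a base if $\{\{\beta\}:\beta\in B\}$ is a generalized base; $gb(\mathcal X)$, $b(\mathcal X)$ are the minimum sizes. For a finite field $\mathbb F$ and a subgroup $K$ of $\mathbb F^\times$, the cyclotomic scheme over $\mathbb F$ is $\mathrm{Inv}(G)$ with $G=\{x\mapsto ax+b: a\in K, b\in\mathbb F\}\le\mathrm{AGL}(1,\mathbb F)$, where $\mathrm{Inv}(G)=(\mathbb F,\text{orbits of }G\text{ on }\mathbb F\times\mathbb F)$. *)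

theory Defs
  imports Main
begin

text \<open>A configuration is a pair (Omega, S) of a point set and a set of basic relations.\<close>
type_synonym 'a config = "'a set \<times> ('a \<times> 'a) set set"

definition coherent_config :: "'a config \<Rightarrow> bool" where
  "coherent_config X \<longleftrightarrow> (case X of (\<Omega>, S) \<Rightarrow>
     finite \<Omega> \<and>
     \<comment> \<open>S is a partition of Omega x Omega\<close>
     (\<forall>s\<in>S. s \<noteq> {}) \<and> \<Union>S = \<Omega> \<times> \<Omega> \<and>
     (\<forall>s\<in>S. \<forall>t\<in>S. s \<noteq> t \<longrightarrow> s \<inter> t = {}) \<and>
     \<comment> \<open>the diagonal is a union of basic relations\<close>
     (\<exists>T\<subseteq>S. \<Union>T = Id_on \<Omega>) \<and>
     \<comment> \<open>closed under transposition\<close>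
     (\<forall>s\<in>S. converse s \<in> S) \<and>
     \<comment> \<open>intersection numbers\<close>
     (\<forall>r\<in>S. \<forall>s\<in>S. \<forall>t\<in>S. \<forall>p\<in>t. \<forall>q\<in>t.
        card {\<gamma>. (fst p, \<gamma>) \<in> r \<and> (\<gamma>, snd p) \<in> s}
        = card {\<gamma>. (fst q, \<gamma>) \<in> r \<and> (\<gamma>, snd q) \<in> s}))"

definition fibers :: "'a config \<Rightarrow> 'a set set" where
  "fibers X = {\<Gamma>. Id_on \<Gamma> \<in> snd X}"

definition antisymmetric_config :: "'a config \<Rightarrow> bool" where
  "antisymmetric_config X \<longleftrightarrow> (\<forall>s\<in>snd X. converse s = s \<longrightarrow> s \<subseteq> Id_on (fst X))"

definition relations :: "'a config \<Rightarrow> ('a \<times> 'a) set set" where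
  "relations X = {\<Union>T | T. T \<subseteq> snd X}"

definition is_fission :: "'a config \<Rightarrow> 'a config \<Rightarrow> bool" where
  "is_fission Y X \<longleftrightarrow> coherent_config Y \<and> fst Y = fst X \<and> relations X \<subseteq> relations Y"

definition complete_config :: "'a config \<Rightarrow> bool" where
  "complete_config X \<longleftrightarrow> (\<forall>s\<in>snd X. \<exists>p. s = {p})"

definition union_of_fibers :: "'a config \<Rightarrow> 'a set \<Rightarrow> bool" where
  "union_of_fibers Y \<Delta> \<longleftrightarrow> (\<exists>F\<subseteq>fibers Y. \<Delta> = \<Union>F)"

definition is_Pi_fission :: "'a config \<Rightarrow> 'a set set \<Rightarrow> 'a config \<Rightarrow> bool" where
  "is_Pi_fission X \<Pi> Y \<longleftrightarrow>
     is_fission Y X \<and> (\<forall>\<Delta>\<in>\<Pi>. union_of_fibers Y \<Delta>) \<and>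
     (\<forall>Y'. is_fission Y' X \<and> (\<forall>\<Delta>\<in>\<Pi>. union_of_fibers Y' \<Delta>) \<longrightarrow> is_fission Y' Y)"

definition generalized_base :: "'a config \<Rightarrow> 'a set set \<Rightarrow> bool" where
  "generalized_base X \<Pi> \<longleftrightarrow> \<Pi> \<subseteq> Pow (fst X) \<and>
     (\<exists>Y. is_Pi_fission X \<Pi> Y \<and> complete_config Y)"

definition base :: "'a config \<Rightarrow> 'a set \<Rightarrow> bool" where
  "base X B \<longleftrightarrow> B \<subseteq> fst X \<and> generalized_base X ((\<lambda>\<beta>. {\<beta>}) ` B)"

definition gb :: "'a config \<Rightarrow> nat" where
  "gb X = (LEAST n. \<exists>\<Pi>. generalized_base X \<Pi> \<and> card \<Pi> = n)"

definition b :: "'a config \<Rightarrow> nat" where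
  "b X = (LEAST n. \<exists>B. base X B \<and> card B = n)"

definition mult_subgroup :: "'a::field set \<Rightarrow> bool" where
  "mult_subgroup K \<longleftrightarrow> K \<subseteq> - {0} \<and> 1 \<in> K \<and> (\<forall>x\<in>K. \<forall>y\<in>K. x * y \<in> K)
     \<and> (\<forall>x\<in>K. inverse x \<in> K)"

definition Inv :: "'a set \<Rightarrow> ('a \<Rightarrow> 'a) set \<Rightarrow> 'a config" where
  "Inv \<Omega> G = (\<Omega>, {{(g x, g y) | g. g \<in> G} | x y. x \<in> \<Omega> \<and> y \<in> \<Omega>})"

definition affine_group_K :: "'a::field set \<Rightarrow> ('a \<Rightarrow> 'a) set" where
  "affine_group_K K = {(\<lambda>x. a * x + c) | a c. a \<in> K}"

definition cyclotomic_scheme :: "'a::{finite,field} set \<Rightarrow> 'a config" where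
  "cyclotomic_scheme K = Inv UNIV (affine_group_K K)"

end

theory Submission
  imports Defs "HOL-Library.Cardinality" "HOL-Algebra.Multiplicative_Group"
    "HOL-Computational_Algebra.Primes"
begin

text \<open>
  Antisymmetry means \<open>-1 \<notin> K\<close>, hence \<open>K\<close> consists of squares and every fission \<open>Y\<close> of the scheme
  refines the Paley colouring \<open>(x - y) ^ ((q - 1) / 2)\<close>. Let \<open>p\<close> be the characteristic,
  \<open>q = p ^ d\<close>, and let \<open>N x = x ^ (1 + p + \<dots> + p ^ (d - 1))\<close> be the norm to the prime field.
  Consider field-valued functions of two points that are constant on the basic relations of \<open>Y\<close>; they
  are closed under pointwise operations and under the matrix product.

  If \<open>{0}\<close> is a fiber, the functions of \<open>t = x / y\<close> among them are closed under multiplicative convolution,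
  and on functions \<open>N (P t)\<close> with \<open>deg P < p\<close> convolution multiplies the coefficients of the
  polynomials (up to an additive constant), because \<open>N (P t)\<close> expands along base-\<open>p\<close> digits.
  Starting from \<open>(1 - t) ^ ((q - 1) / 2) = N ((1 - t) ^ k)\<close> with \<open>k = (p - 1) / 2\<close> this yields
  \<open>N (1 - t)\<close>. Convolving \<open>N (1 - t)\<close> with \<open>N\<close> of a polynomial \<open>c\<^sub>0 + c\<^sub>1 t + c\<^sub>2 t\<^sup>2\<close> gives
  \<open>N (c\<^sub>0 - c\<^sub>1 t)\<close>, whose only zero is thereby a singleton fiber.

  Consequently the set of singleton fibers is closed under point reflections and, if it contains 0,
  under \<open>(z, w) \<mapsto> - z w / (z + w)\<close>. If it also contains 1 it is a subfield, so it is everything as soon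
  as it contains a primitive root \<open>\<beta>\<close>: thus \<open>{0, 1, \<beta>}\<close> is a base. After replacing \<open>\<beta>\<close> by \<open>- \<beta>\<close> if
  necessary, antisymmetry separates the points of \<open>{0, 1, \<beta>}\<close>, so this one set is a generalized base.
\<close>

section \<open>Finite fields\<close>

lemma prime_CHAR_finite_field: "prime CHAR('a::{finite,field})"
  by (intro prime_CHAR_semidom finite_imp_CHAR_pos) simp

text \<open>Carries the cyclicity of the unit group over from the carrier-based fields of
  HOL-Algebra; \<open>R\<close> packages the type class operations as such a field.\<close>

lemma finite_field_has_generator:
  "\<exists>g::'a::{finite,field}. g \<noteq> 0 \<and> (\<forall>x. x \<noteq> 0 \<longrightarrow> (\<exists>i::nat. x = g ^ i))"
proof -
  define R :: "'a ring" where "R = \<lparr>carrier = (UNIV :: 'a set), monoid.mult = (*), one = 1, ring.zero = 0, add = (+)\<rparr>"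
  have "\<exists>y. x + y = 0 \<and> y + x = 0" for x :: 'a
    by (rule exI[of _ "- x"]) simp
  moreover have "\<exists>y. x * y = 1 \<and> y * x = 1" if "x \<noteq> 0" for x :: 'a
    by (rule exI[of _ "inverse x"]) (use that in simp)
  ultimately interpret R: field R
    by unfold_locales (auto simp: R_def Units_def algebra_simps)
  have pow: "a [^]\<^bsub>R\<^esub> i = a ^ i" for a and i :: nat
    by (induction i) (auto simp: R_def nat_pow_def)
  have "\<exists>a\<in>carrier (mult_of R). carrier (mult_of R) = {a [^]\<^bsub>R\<^esub> i | i::nat. i \<in> UNIV}"
    by (rule R.finite_field_mult_group_has_gen) (simp add: R_def)
  then obtain g where g: "g \<in> carrier (mult_of R)"
    "carrier (mult_of R) = {g [^]\<^bsub>R\<^esub> i | i::nat. i \<in> UNIV}" by blast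
  have "carrier (mult_of R) = - {0}" by (auto simp: R_def)
  then have "g \<noteq> 0" and *: "- {0} = {g ^ i | i::nat. i \<in> UNIV}"
    using g unfolding pow by simp_all
  have "\<exists>i::nat. x = g ^ i" if "x \<noteq> 0" for x
  proof -
    have "x \<in> {g ^ i | i::nat. i \<in> UNIV}" unfolding *[symmetric] using that by simp
    then show ?thesis by auto
  qed
  with \<open>g \<noteq> 0\<close> show ?thesis by (intro exI[of _ g]) simp
qed

text \<open>Multiplication by \<open>x\<close> permutes the nonzero elements and so preserves their
  product.\<close>

lemma finite_field_power_card_minus_1:
  fixes x :: "'a::{finite,field}"
  assumes "x \<noteq> 0"
  shows "x ^ (CARD('a) - 1) = 1"
proof -
  have "(\<Prod>y\<in>UNIV-{0}. y) = (\<Prod>y\<in>UNIV-{0}. x * y)"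
    by (rule prod.reindex_bij_witness[of _ "\<lambda>y. x * y" "\<lambda>y. y / x"]) (use assms in auto)
  also have "\<dots> = x ^ (CARD('a) - 1) * (\<Prod>y\<in>UNIV-{0}. y)"
    by (simp add: prod.distrib)
  finally show ?thesis by simp
qed

text \<open>If \<open>q - 1\<close> divides \<open>l\<close>, all \<open>q - 1\<close> summands are
  1. Otherwise a generator \<open>g\<close> has \<open>g ^ l \<noteq> 1\<close>, while substituting
  \<open>g * y\<close> for \<open>y\<close> multiplies the sum by \<open>g ^ l\<close>, so the sum
  vanishes.\<close>

lemma sum_power_finite_field:
  "(\<Sum>y\<in>UNIV-{0::'a::{finite,field}}. y ^ l) = (if CARD('a) - 1 dvd l then - 1 else 0)"
proof (cases "CARD('a) - 1 dvd l")
  case True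
  then obtain m where l: "l = (CARD('a) - 1) * m" by blast
  have "(\<Sum>y\<in>UNIV-{0::'a}. y ^ l) = (\<Sum>y\<in>UNIV-{0::'a}. 1)"
    by (intro sum.cong) (auto simp: l power_mult finite_field_power_card_minus_1 simp del: One_nat_def)
  also have "\<dots> = of_nat (CARD('a) - 1)" by simp
  also have "\<dots> = of_nat CARD('a) - 1"
    by (subst of_nat_diff) (auto simp: Suc_le_eq)
  also have "of_nat CARD('a) = (0::'a)"
  proof -
    have "(\<Sum>y\<in>UNIV. y + 1) = (\<Sum>y\<in>UNIV. y :: 'a)"
      by (rule sum.reindex_bij_witness[of _ "\<lambda>y. y - 1" "\<lambda>y. y + 1"]) auto
    then show ?thesis by (simp add: sum.distrib)
  qed
  finally show ?thesis using True by simp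
next
  case False
  obtain g :: 'a where g: "g \<noteq> 0" "\<And>x. x \<noteq> 0 \<Longrightarrow> \<exists>i::nat. x = g ^ i"
    using finite_field_has_generator by blast
  let ?r = "l mod (CARD('a) - 1)"
  have "CARD('a) \<ge> 2"
    using card_mono[of UNIV "{0, 1::'a}"] by simp
  have "g ^ l \<noteq> 1"
  proof
    assume "g ^ l = 1"
    have "g ^ l = g ^ ((CARD('a) - 1) * (l div (CARD('a) - 1)) + ?r)" by simp
    also have "\<dots> = g ^ ?r"
      by (simp only: power_add power_mult finite_field_power_card_minus_1[OF g(1)]) simp
    finally have r: "g ^ ?r = 1" using \<open>g ^ l = 1\<close> by simp
    have "?r > 0" using False by (simp add: dvd_eq_mod_eq_0)
    \<comment> \<open>With \<open>g ^ ?r = 1\<close> the powers of \<open>g\<close> would take at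
      most \<open>?r < q - 1\<close> values.\<close>
    have "UNIV - {0} \<subseteq> (\<lambda>i. g ^ i) ` {..<?r}"
    proof
      fix x :: 'a assume "x \<in> UNIV - {0}"
      then obtain i :: nat where "x = g ^ i" using g(2) by blast
      also have "\<dots> = g ^ (?r * (i div ?r) + i mod ?r)" by simp
      also have "\<dots> = g ^ (i mod ?r)" by (simp only: power_add power_mult r) simp
      finally show "x \<in> (\<lambda>i. g ^ i) ` {..<?r}" using \<open>?r > 0\<close> by simp
    qed
    then have "card (UNIV - {0::'a}) \<le> card ((\<lambda>i. g ^ i) ` {..<?r})"
      by (intro card_mono) auto
    also have "\<dots> \<le> ?r" using card_image_le[of "{..<?r}" "\<lambda>i. g ^ i"] by simp
    also have "\<dots> < CARD('a) - 1" using \<open>CARD('a) \<ge> 2\<close> by (intro mod_less_divisor) simp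
    finally show False by simp
  qed
  have "(\<Sum>y\<in>UNIV-{0}. y ^ l) = (\<Sum>y\<in>UNIV-{0}. (g * y) ^ l)"
    by (rule sum.reindex_bij_witness[of _ "\<lambda>y. g * y" "\<lambda>y. y / g"]) (use g in auto)
  also have "\<dots> = g ^ l * (\<Sum>y\<in>UNIV-{0}. y ^ l)"
    by (simp add: power_mult_distrib sum_distrib_left)
  finally have "(g ^ l - 1) * (\<Sum>y\<in>UNIV-{0}. y ^ l) = 0"
    by (simp add: algebra_simps)
  with \<open>g ^ l \<noteq> 1\<close> False show ?thesis by simp
qed

text \<open>Among the additive subgroups whose order is a power of the characteristic, take
  \<open>U\<close> of maximal order. For \<open>u\<close> outside \<open>U\<close>, the cosets of
  \<open>U\<close> by the multiples of \<open>u\<close> would form a subgroup larger by the factor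
  \<open>CHAR('a)\<close>, so \<open>U\<close> is everything.\<close>

lemma card_finite_field_prime_power:
  "\<exists>d. CARD('a::{finite,field}) = CHAR('a) ^ d"
proof -
  let ?p = "CHAR('a)"
  define G where "G = {U::'a set. 0 \<in> U \<and> (\<forall>x\<in>U. \<forall>y\<in>U. x - y \<in> U) \<and> (\<exists>d. card U = ?p ^ d)}"
  have "{0} \<in> G" unfolding G_def by (intro CollectI conjI exI[of _ 0]) auto
  then obtain U where "U \<in> G" and "Max (card ` G) = card U"
    using obtains_MAX[of G card] by (metis empty_iff finite)
  then have U: "U \<in> G" "\<And>V. V \<in> G \<Longrightarrow> card V \<le> card U"
    by (auto simp flip: \<open>Max (card ` G) = card U\<close>)
  obtain d where d: "card U = ?p ^ d" using U(1) unfolding G_def by blast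
  have diff: "x - y \<in> U" if "x \<in> U" "y \<in> U" for x y using U(1) that unfolding G_def by blast
  have zero: "0 \<in> U" using U(1) unfolding G_def by blast
  have add: "x + y \<in> U" if "x \<in> U" "y \<in> U" for x y
    using diff[OF that(1) diff[OF zero that(2)]] by simp
  have mult: "of_nat c * x \<in> U" if "x \<in> U" for x and c :: nat
    by (induction c) (use zero add that in \<open>auto simp: algebra_simps\<close>)
  have p: "prime ?p" by (rule prime_CHAR_finite_field)
  have "U = UNIV"
  proof (rule ccontr)
    assume "U \<noteq> UNIV"
    then obtain u where u: "u \<notin> U" by blast
    define f where "f = (\<lambda>(c, x). of_nat c * u + x)"
    have red: "of_nat c = (of_nat (c mod ?p) :: 'a)" for c
    proof -
      have "of_nat c = (of_nat (?p * (c div ?p) + c mod ?p) :: 'a)" by simp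
      also have "\<dots> = of_nat (c mod ?p)" by (simp only: of_nat_add of_nat_mult of_nat_CHAR) simp
      finally show ?thesis .
    qed
    \<comment> \<open>Different multiples of \<open>u\<close> lie in different cosets: the
      difference of their factors is invertible modulo the characteristic, so otherwise
      \<open>u\<close> would lie in \<open>U\<close>.\<close>
    have key: "c1 = c2" if c: "c1 < ?p" "c2 < ?p" "c1 \<le> c2"
      and eq: "of_nat c1 * u + x1 = of_nat c2 * u + x2" "x1 \<in> U" "x2 \<in> U" for c1 c2 x1 x2
    proof (rule ccontr)
      assume "c1 \<noteq> c2"
      then have "0 < c2 - c1" "c2 - c1 < ?p" using c by auto
      then have "coprime (c2 - c1) ?p"
        using p by (metis coprime_commute nat_dvd_not_less prime_imp_coprime_nat)
      then obtain m n where "(c2 - c1) * m = ?p * n + 1"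
        using \<open>0 < c2 - c1\<close> by (metis bezout_nat coprime_imp_gcd_eq_1 less_numeral_extra(3))
      then have m: "of_nat m * of_nat (c2 - c1) = (1::'a)"
        by (metis add_0 mult.commute mult_zero_left of_nat_1 of_nat_CHAR of_nat_add of_nat_mult)
      have "of_nat (c2 - c1) * u = x1 - x2"
        using eq(1) c(3) by (simp add: of_nat_diff algebra_simps)
      then have "of_nat (c2 - c1) * u \<in> U" using diff eq by simp
      from mult[OF this, of m] have "u \<in> U" using m by (simp add: mult.assoc[symmetric])
      with u show False by blast
    qed
    have inj: "inj_on f ({..<?p} \<times> U)"
    proof (rule inj_onI)
      fix a a' assume "a \<in> {..<?p} \<times> U" "a' \<in> {..<?p} \<times> U" "f a = f a'"
      moreover obtain c x c' x' where "a = (c, x)" "a' = (c', x')" by fastforce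
      ultimately show "a = a'"
        using key[of c c' x x'] key[of c' c x' x] by (cases "c \<le> c'") (auto simp: f_def)
    qed
    let ?V = "f ` ({..<?p} \<times> U)"
    have memV: "of_nat c * u + x \<in> ?V" if "x \<in> U" for c x
      by (rule image_eqI[of _ _ "(c mod ?p, x)"])
        (use that red[of c] p in \<open>auto simp: f_def prime_gt_0_nat\<close>)
    have "?V \<in> G"
      unfolding G_def
    proof (intro CollectI conjI ballI)
      show "0 \<in> ?V" using memV[OF zero, of 0] by simp
      show "\<exists>d. card ?V = ?p ^ d"
        by (rule exI[of _ "Suc d"]) (simp add: card_image[OF inj] d)
    next
      fix v w assume "v \<in> ?V" "w \<in> ?V"
      then obtain c x c' x' where vw: "v = of_nat c * u + x" "w = of_nat c' * u + x'"
        "c' < ?p" "x \<in> U" "x' \<in> U" by (auto simp: f_def)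
      have "v - w = of_nat (c + (?p - c')) * u + (x - x')"
        using vw(3) by (simp add: vw of_nat_diff[OF less_imp_le[OF vw(3)]] algebra_simps)
      then show "v - w \<in> ?V" using memV[OF diff[OF vw(4,5)]] by metis
    qed
    then have "card ?V \<le> card U" by (rule U(2))
    moreover have "card ?V = ?p * card U" by (simp add: card_image[OF inj])
    moreover have "card U > 0" using zero by (auto simp: card_gt_0_iff)
    moreover have "?p > 1" using p prime_gt_1_nat by blast
    ultimately show False by simp
  qed
  then show ?thesis using d by blast
qed

section \<open>Norms of polynomials of small degree\<close>

definition norm_exp :: "nat \<Rightarrow> nat \<Rightarrow> nat" where
  "norm_exp p d = (\<Sum>i<d. p ^ i)"

text \<open>
  The coefficient of \<open>y ^ l\<close> in \<open>(\<Sum>j<p. a j * y ^ j) ^ norm_exp p d\<close>: the product of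
  \<open>a (l\<^sub>i) ^ (p ^ i)\<close> over the base-\<open>p\<close> digits \<open>l\<^sub>i\<close> of \<open>l\<close>.
\<close>
primrec digit_coeff :: "nat \<Rightarrow> (nat \<Rightarrow> 'a::comm_semiring_1) \<Rightarrow> nat \<Rightarrow> nat \<Rightarrow> 'a" where
  "digit_coeff p a 0 l = 1"
| "digit_coeff p a (Suc d) l = digit_coeff p a d (l mod p ^ d) * a (l div p ^ d) ^ (p ^ d)"

lemma digit_coeff_mult:
  "digit_coeff p f d l * digit_coeff p g d l = digit_coeff p (\<lambda>j. f j * g j) d l"
proof (induction d arbitrary: l)
  case (Suc d)
  show ?case by (simp add: Suc[symmetric] power_mult_distrib ac_simps)
qed simp

lemma digit_coeff_0: "p > 0 \<Longrightarrow> digit_coeff p f d 0 = f 0 ^ norm_exp p d"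
  by (induction d) (auto simp: norm_exp_def power_add)

text \<open>All \<open>d\<close> base-\<open>p\<close> digits of \<open>p ^ d - 1\<close> equal
  \<open>p - 1\<close>.\<close>

lemma digit_coeff_last:
  assumes "p > 0"
  shows "digit_coeff p f d (p ^ d - 1) = f (p - 1) ^ norm_exp p d"
proof (induction d)
  case (Suc d)
  have eq: "p ^ Suc d - 1 = (p - 1) * p ^ d + (p ^ d - 1)"
    using assms by (cases p) (auto simp: algebra_simps)
  have "p ^ d - 1 < p ^ d" using assms by simp
  then have "(p ^ Suc d - 1) mod p ^ d = p ^ d - 1" "(p ^ Suc d - 1) div p ^ d = p - 1"
    unfolding eq by (simp_all only: mod_mult_self3 mod_less div_mult_self3[OF less_imp_neq[OF zero_less_power[OF assms], symmetric]] div_less add_0_right)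
  then show ?case using Suc by (simp add: norm_exp_def power_add del: power_Suc)
qed (simp add: norm_exp_def)

text \<open>The exponent is the sum of the powers \<open>p ^ i\<close>, and raising to the power
  \<open>p ^ i\<close> is additive, so the factor for \<open>i\<close> contributes the terms
  \<open>f j ^ (p ^ i) * y ^ (j * p ^ i)\<close>. By uniqueness of base-\<open>p\<close> digits
  every exponent below \<open>p ^ d\<close> occurs exactly once.\<close>

lemma norm_poly_expand:
  fixes f :: "nat \<Rightarrow> 'a::comm_semiring_1"
  assumes p: "prime CHAR('a)" and p_def: "p = CHAR('a)"
  shows "(\<Sum>j<p. f j * y ^ j) ^ norm_exp p d = (\<Sum>l<p ^ d. digit_coeff p f d l * y ^ l)"
proof (induction d)
  case (Suc d)
  have p_pos: "p > 0" using p p_def prime_gt_0_nat by simp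
  have "(\<Sum>j<p. f j * y ^ j) ^ norm_exp p (Suc d)
      = (\<Sum>l<p ^ d. digit_coeff p f d l * y ^ l) * (\<Sum>j<p. f j * y ^ j) ^ (p ^ d)"
    unfolding Suc[symmetric] by (simp add: norm_exp_def power_add)
  also have "(\<Sum>j<p. f j * y ^ j) ^ (p ^ d) = (\<Sum>j<p. f j ^ (p ^ d) * y ^ (j * p ^ d))"
    using freshmans_dream_sum'[OF p, of "p ^ d" d, folded p_def, OF refl, of "\<lambda>j. f j * y ^ j" "{..<p}"]
    by (simp add: power_mult_distrib power_mult)
  also have "(\<Sum>l<p ^ d. digit_coeff p f d l * y ^ l) * \<dots>
      = (\<Sum>j<p. \<Sum>l<p ^ d. digit_coeff p f d l * f j ^ (p ^ d) * y ^ (l + j * p ^ d))"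
    by (subst sum.swap) (simp add: sum_product power_add mult_ac)
  \<comment> \<open>Block \<open>j\<close> consists of the exponents with leading digit
    \<open>j\<close>.\<close>
  also have "\<dots> = (\<Sum>j<p. \<Sum>l\<in>{j * p ^ d..<j * p ^ d + p ^ d}. digit_coeff p f (Suc d) l * y ^ l)"
  proof (rule sum.cong)
    fix j assume "j \<in> {..<p}"
    show "(\<Sum>l<p ^ d. digit_coeff p f d l * f j ^ (p ^ d) * y ^ (l + j * p ^ d))
        = (\<Sum>l\<in>{j * p ^ d..<j * p ^ d + p ^ d}. digit_coeff p f (Suc d) l * y ^ l)"
      by (rule sum.reindex_bij_witness[of _ "\<lambda>l. l - j * p ^ d" "\<lambda>l. l + j * p ^ d"])
        (auto simp: div_add1_eq[of _ "j * p ^ d"] p_pos)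
  qed simp
  also have "\<dots> = (\<Sum>l<p ^ Suc d. digit_coeff p f (Suc d) l * y ^ l)"
    by (subst sum.nat_group) (simp add: mult.commute)
  finally show ?case .
qed (simp add: norm_exp_def)

text \<open>
  The second summand on the right arises from \<open>s ^ (q - 1) = s ^ 0\<close>; the hypothesis on \<open>f\<close> removes the
  symmetric one.
\<close>
lemma norm_poly_convolution:
  fixes f g :: "nat \<Rightarrow> 'a::{finite,field}" and t :: 'a
  assumes p_def: "p = CHAR('a)" and q: "CARD('a) = p ^ d" and top: "f (p - 1) = 0" and t: "t \<noteq> 0"
  shows "(\<Sum>s\<in>UNIV-{0}. (\<Sum>j<p. f j * (t / s) ^ j) ^ norm_exp p d * (\<Sum>j<p. g j * s ^ j) ^ norm_exp p d)
       = - ((\<Sum>j<p. f j * g j * t ^ j) ^ norm_exp p d + (f 0 * g (p - 1)) ^ norm_exp p d)"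
    (is "?L = _")
proof -
  have pr: "prime CHAR('a)" by (rule prime_CHAR_finite_field)
  then have p1: "p > 1" using prime_gt_1_nat p_def by simp
  have q2: "CARD('a) \<ge> 2" using card_mono[of UNIV "{0, 1::'a}"] by simp
  have d: "d > 0" using q q2 by (cases d) auto
  then have e: "norm_exp p d > 0" using p1 by (cases d) (auto simp: norm_exp_def lessThan_Suc_eq_insert_0)
  let ?Q = "p ^ d"
  define F where "F = digit_coeff p f d"
  define G where "G = digit_coeff p g d"
  have F_last: "F (?Q - 1) = 0"
    using digit_coeff_last[of p f d] e p1 unfolding F_def top by (simp add: zero_power)
  have "?L = (\<Sum>s\<in>UNIV-{0}. (\<Sum>l<?Q. F l * (t / s) ^ l) * (\<Sum>m<?Q. G m * s ^ m))"
    unfolding F_def G_def using norm_poly_expand[OF pr p_def, of f _ d] norm_poly_expand[OF pr p_def, of g _ d]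
    by simp
  \<comment> \<open>Since \<open>s ^ (q - 1) = 1\<close>, the factor \<open>1 / s ^ l\<close> can be
    written as \<open>s ^ (q - 1 - l)\<close>.\<close>
  also have "\<dots> = (\<Sum>s\<in>UNIV-{0}. \<Sum>l<?Q. \<Sum>m<?Q. F l * G m * t ^ l * s ^ (m + (?Q - 1 - l)))"
  proof (rule sum.cong)
    fix s :: 'a assume "s \<in> UNIV - {0}"
    then have s: "s \<noteq> 0" by simp
    have "(t / s) ^ l * s ^ m = t ^ l * s ^ (m + (?Q - 1 - l))" if "l < ?Q" for l m
    proof -
      have "s ^ l * s ^ (?Q - 1 - l) = s ^ (?Q - 1)"
        using that by (simp flip: power_add)
      also have "\<dots> = 1" using finite_field_power_card_minus_1[OF s] by (simp add: q)
      finally show ?thesis using s by (simp add: field_simps power_add)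
    qed
    then show "(\<Sum>l<?Q. F l * (t / s) ^ l) * (\<Sum>m<?Q. G m * s ^ m)
       = (\<Sum>l<?Q. \<Sum>m<?Q. F l * G m * t ^ l * s ^ (m + (?Q - 1 - l)))"
      unfolding sum_product by (intro sum.cong refl) (metis (no_types, lifting) lessThan_iff mult.assoc mult.left_commute)
  qed simp
  also have "\<dots> = (\<Sum>l<?Q. \<Sum>m<?Q. \<Sum>s\<in>UNIV-{0}. F l * G m * t ^ l * s ^ (m + (?Q - 1 - l)))"
    by (rule trans[OF sum.swap], intro sum.cong refl, rule sum.swap)
  also have "\<dots> = (\<Sum>l<?Q. \<Sum>m<?Q. F l * G m * t ^ l * (if ?Q - 1 dvd m + (?Q - 1 - l) then - 1 else 0))"
    unfolding sum_distrib_left[symmetric] sum_power_finite_field q ..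
  also have "\<dots> = (\<Sum>l<?Q. \<Sum>m<?Q. (if m = l then - (F l * G l * t ^ l) else 0)
      + (if l = 0 \<and> m = ?Q - 1 then - (F 0 * G (?Q - 1)) else 0))"
  proof (intro sum.cong refl)
    fix l m assume lm: "l \<in> {..<?Q}" "m \<in> {..<?Q}"
    show "F l * G m * t ^ l * (if ?Q - 1 dvd m + (?Q - 1 - l) then - 1 else 0)
        = (if m = l then - (F l * G l * t ^ l) else 0)
        + (if l = 0 \<and> m = ?Q - 1 then - (F 0 * G (?Q - 1)) else 0)"
    proof (cases "l = ?Q - 1")
      case True
      then show ?thesis using F_last q q2 by auto
    next
      case False
      \<comment> \<open>For \<open>l < q - 1\<close> the exponent is positive and at most
        \<open>2 * (q - 1)\<close>; the upper end is attained only for \<open>l = 0\<close> and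
        \<open>m = q - 1\<close>.\<close>
      have "?Q - 1 dvd m + (?Q - 1 - l) \<longleftrightarrow> m = l \<or> (l = 0 \<and> m = ?Q - 1)"
      proof
        assume "?Q - 1 dvd m + (?Q - 1 - l)"
        then obtain c where c: "m + (?Q - 1 - l) = (?Q - 1) * c" by blast
        have "0 < m + (?Q - 1 - l)" "m + (?Q - 1 - l) \<le> (?Q - 1) * 2"
          using lm False by auto
        then have "0 < c" "c \<le> 2" using q q2 unfolding c by auto
        then have "c = 1 \<or> c = 2" by linarith
        then have "m + (?Q - 1 - l) = ?Q - 1 \<or> m + (?Q - 1 - l) = 2 * (?Q - 1)"
          using c by auto
        moreover have "l \<le> ?Q - 1" "m \<le> ?Q - 1" using lm by auto
        ultimately show "m = l \<or> (l = 0 \<and> m = ?Q - 1)" by linarith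
      next
        assume "m = l \<or> (l = 0 \<and> m = ?Q - 1)"
        then have "m + (?Q - 1 - l) = ?Q - 1 \<or> m + (?Q - 1 - l) = (?Q - 1) + (?Q - 1)"
          using lm by auto
        then show "?Q - 1 dvd m + (?Q - 1 - l)" by (metis dvd_add dvd_refl)
      qed
      then show ?thesis using q q2 by auto
    qed
  qed
  also have "\<dots> = (\<Sum>l<?Q. - (F l * G l * t ^ l)) + (\<Sum>l<?Q. if l = 0 then - (F 0 * G (?Q - 1)) else 0)"
    unfolding sum.distrib by (intro arg_cong2[of _ _ _ _ "(+)"] sum.cong refl) auto
  also have "\<dots> = - ((\<Sum>l<?Q. F l * G l * t ^ l) + F 0 * G (?Q - 1))"
    using p1 by (simp add: sum_negf)
  also have "(\<Sum>l<?Q. F l * G l * t ^ l) = (\<Sum>j<p. f j * g j * t ^ j) ^ norm_exp p d"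
    using norm_poly_expand[OF pr p_def, of "\<lambda>j. f j * g j" t d] by (simp add: F_def G_def digit_coeff_mult)
  also have "F 0 * G (?Q - 1) = (f 0 * g (p - 1)) ^ norm_exp p d"
    using p1 digit_coeff_0[of p f d] digit_coeff_last[of p g d]
    by (simp add: F_def G_def power_mult_distrib)
  finally show ?thesis .
qed

section \<open>Functions constant on basic relations\<close>

text \<open>The value type is arbitrary: field values give matrices of the adjacency algebra, truth
  values give unions of basic relations (\<open>relations_iff\<close>).\<close>

definition class_fun :: "'a config \<Rightarrow> ('a \<Rightarrow> 'a \<Rightarrow> 'v) \<Rightarrow> bool" where
  "class_fun Y M \<longleftrightarrow> (\<forall>s\<in>snd Y. \<forall>p\<in>s. \<forall>q\<in>s. M (fst p) (snd p) = M (fst q) (snd q))"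

lemma class_funI:
  "(\<And>s x y x' y'. s \<in> snd Y \<Longrightarrow> (x, y) \<in> s \<Longrightarrow> (x', y') \<in> s \<Longrightarrow> M x y = M x' y') \<Longrightarrow> class_fun Y M"
  unfolding class_fun_def by (metis prod.collapse)

lemma class_funD:
  "class_fun Y M \<Longrightarrow> s \<in> snd Y \<Longrightarrow> (x, y) \<in> s \<Longrightarrow> (x', y') \<in> s \<Longrightarrow> M x y = M x' y'"
  unfolding class_fun_def by (metis fst_conv snd_conv)

lemma class_fun_const: "class_fun Y (\<lambda>x y. c)"
  by (rule class_funI) simp

lemma class_fun_comp: "class_fun Y M \<Longrightarrow> class_fun Y (\<lambda>x y. h (M x y))"
  by (rule class_funI) (rule arg_cong[of _ _ h], rule class_funD)

lemma class_fun_comp2: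
  "class_fun Y M \<Longrightarrow> class_fun Y M' \<Longrightarrow> class_fun Y (\<lambda>x y. h (M x y) (M' x y))"
  by (rule class_funI) (intro arg_cong2[of _ _ _ _ h]; rule class_funD)

locale coherent_on_UNIV =
  fixes Y :: "'a::finite config"
  assumes coherent: "coherent_config Y" and UNIV_points: "fst Y = UNIV"
begin

abbreviation "cf \<equiv> class_fun Y"

lemma
  shows cover: "\<Union>(snd Y) = UNIV"
    and disjoint: "s \<in> snd Y \<Longrightarrow> t \<in> snd Y \<Longrightarrow> p \<in> s \<Longrightarrow> p \<in> t \<Longrightarrow> s = t"
    and diag: "\<exists>T\<subseteq>snd Y. \<Union>T = Id"
    and conv: "s \<in> snd Y \<Longrightarrow> converse s \<in> snd Y"
    and inter: "r \<in> snd Y \<Longrightarrow> s \<in> snd Y \<Longrightarrow> t \<in> snd Y \<Longrightarrow> (x, z) \<in> t \<Longrightarrow> (x', z') \<in> t \<Longrightarrow>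
      card {y. (x, y) \<in> r \<and> (y, z) \<in> s} = card {y. (x', y) \<in> r \<and> (y, z') \<in> s}"
proof -
  obtain S where Y: "Y = (UNIV, S)" using UNIV_points by (metis prod.collapse)
  note c = coherent[unfolded Y coherent_config_def prod.case]
  show "\<Union>(snd Y) = UNIV" using c Y by simp
  show "s \<in> snd Y \<Longrightarrow> t \<in> snd Y \<Longrightarrow> p \<in> s \<Longrightarrow> p \<in> t \<Longrightarrow> s = t"
  proof (rule ccontr)
    assume "s \<in> snd Y" "t \<in> snd Y" "p \<in> s" "p \<in> t" "s \<noteq> t"
    then have "s \<inter> t = {}" using c Y by simp
    with \<open>p \<in> s\<close> \<open>p \<in> t\<close> show False by blast
  qed
  show "\<exists>T\<subseteq>snd Y. \<Union>T = Id" proof -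
    have "Id_on UNIV = (Id :: ('a \<times> 'a) set)" by auto
    then show ?thesis using c Y by simp
  qed
  show "s \<in> snd Y \<Longrightarrow> converse s \<in> snd Y" using c Y by simp
  have i: "\<forall>r\<in>S. \<forall>s\<in>S. \<forall>t\<in>S. \<forall>p\<in>t. \<forall>q\<in>t.
        card {\<gamma>. (fst p, \<gamma>) \<in> r \<and> (\<gamma>, snd p) \<in> s}
        = card {\<gamma>. (fst q, \<gamma>) \<in> r \<and> (\<gamma>, snd q) \<in> s}" using c by blast
  show "r \<in> snd Y \<Longrightarrow> s \<in> snd Y \<Longrightarrow> t \<in> snd Y \<Longrightarrow> (x, z) \<in> t \<Longrightarrow> (x', z') \<in> t \<Longrightarrow>
      card {y. (x, y) \<in> r \<and> (y, z) \<in> s} = card {y. (x', y) \<in> r \<and> (y, z') \<in> s}"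
    using i[rule_format, of r s t "(x, z)" "(x', z')"] Y by simp
qed

lemma class_fun_eq: "cf (\<lambda>x y. x = y)"
proof (rule class_funI)
  fix s x y x' y' assume s: "s \<in> snd Y" "(x, y) \<in> s" "(x', y') \<in> s"
  obtain T where T: "T \<subseteq> snd Y" "\<Union>T = Id" using diag by blast
  have "a' = b'" if "(a, a) \<in> s" "(a', b') \<in> s" for a a' b'
  proof -
    obtain t where "t \<in> T" "(a, a) \<in> t" using T(2) by blast
    then have "s = t" using disjoint T(1) s(1) that by blast
    then show ?thesis using T(2) \<open>t \<in> T\<close> that by blast
  qed
  then show "(x = y) = (x' = y')" using s by blast
qed

lemma class_fun_converse: "cf M \<Longrightarrow> cf (\<lambda>x y. M y x)"
  by (rule class_funI, erule class_funD[where s = "converse _"]) (auto intro: conv)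

text \<open>Group the points \<open>y\<close> by the basic relations of \<open>(x, y)\<close> and
  \<open>(y, z)\<close>: the summand is constant on each group, and the group sizes are intersection
  numbers. The general \<open>h\<close> covers both the matrix product and the counting of
  witnesses.\<close>

lemma class_fun_sum:
  fixes h :: "'v \<Rightarrow> 'w \<Rightarrow> 'c::comm_semiring_1"
  assumes "cf M" "cf M'"
  shows "cf (\<lambda>x z. \<Sum>y\<in>UNIV. h (M x y) (M' y z))"
proof (rule class_funI)
  fix t x z x' z' assume t: "t \<in> snd Y" "(x, z) \<in> t" "(x', z') \<in> t"
  define rep where "rep r = (SOME p::'a \<times> 'a. p \<in> r)" for r
  define val where "val r = M (fst (rep r)) (snd (rep r))" for r
  define val' where "val' r = M' (fst (rep r)) (snd (rep r))" for r
  have val: "M u v = val r" "M' u v = val' r" if "r \<in> snd Y" "(u, v) \<in> r" for u v r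
  proof -
    have "(fst (rep r), snd (rep r)) \<in> r" unfolding rep_def prod.collapse using that(2) by (rule someI)
    then show "M u v = val r" "M' u v = val' r"
      unfolding val_def val'_def
      using class_funD[OF assms(1) that] class_funD[OF assms(2) that] by blast+
  qed
  have *: "(\<Sum>y\<in>UNIV. h (M u y) (M' y v))
      = (\<Sum>(r, s)\<in>snd Y \<times> snd Y. of_nat (card {y. (u, y) \<in> r \<and> (y, v) \<in> s}) * h (val r) (val' s))" for u v
  proof -
    define c where "c p = (THE r. r \<in> snd Y \<and> p \<in> r)" for p
    have c: "c p \<in> snd Y \<and> p \<in> c p" for p
      unfolding c_def by (rule theI') (use cover disjoint in blast)
    have ceq: "c p = r \<longleftrightarrow> p \<in> r" if "r \<in> snd Y" for p r
      using c that disjoint by blast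
    have "(\<Sum>y\<in>UNIV. h (M u y) (M' y v))
      = (\<Sum>rs\<in>snd Y \<times> snd Y. \<Sum>y\<in>{y\<in>UNIV. (c (u, y), c (y, v)) = rs}. h (M u y) (M' y v))"
      by (rule sum.group[symmetric]) (use c in auto)
    also have "\<dots> = (\<Sum>(r, s)\<in>snd Y \<times> snd Y. \<Sum>y\<in>{y. (u, y) \<in> r \<and> (y, v) \<in> s}. h (val r) (val' s))"
    proof (rule sum.cong)
      fix rs assume "rs \<in> snd Y \<times> snd Y"
      then obtain r s where rs: "rs = (r, s)" "r \<in> snd Y" "s \<in> snd Y" by blast
      show "(\<Sum>y\<in>{y\<in>UNIV. (c (u, y), c (y, v)) = rs}. h (M u y) (M' y v))
        = (case rs of (r, s) \<Rightarrow> \<Sum>y\<in>{y. (u, y) \<in> r \<and> (y, v) \<in> s}. h (val r) (val' s))"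
        unfolding rs(1) prod.case using val rs(2,3)
        by (intro sum.cong) (auto simp: ceq)
    qed simp
    finally show ?thesis by simp
  qed
  show "(\<Sum>y\<in>UNIV. h (M x y) (M' y z)) = (\<Sum>y\<in>UNIV. h (M x' y) (M' y z'))"
    unfolding *
  proof (rule sum.cong[OF refl])
    fix rs assume "rs \<in> snd Y \<times> snd Y"
    then obtain r s where rs: "rs = (r, s)" "r \<in> snd Y" "s \<in> snd Y" by blast
    show "(case rs of (r, s) \<Rightarrow> of_nat (card {y. (x, y) \<in> r \<and> (y, z) \<in> s}) * h (val r) (val' s))
      = (case rs of (r, s) \<Rightarrow> of_nat (card {y. (x', y) \<in> r \<and> (y, z') \<in> s}) * h (val r) (val' s))"
      unfolding rs(1) prod.case inter[OF rs(2,3) t] ..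
  qed
qed

text \<open>A witness exists iff the number of witnesses, a sum as in \<open>class_fun_sum\<close>,
  is nonzero.\<close>

lemma class_fun_ex:
  assumes "cf M" "cf M'"
  shows "cf (\<lambda>x z. \<exists>y. M x y \<and> M' y z)"
proof -
  have "cf (\<lambda>x z. (\<Sum>y\<in>UNIV. of_bool (M x y \<and> M' y z) :: nat) \<noteq> 0)"
    by (rule class_fun_comp, rule class_fun_sum[OF assms])
  then show ?thesis by simp
qed

section \<open>Singleton fibers (\<open>fixed\<close>) and unions of fibers
  (\<open>definable\<close>)\<close>

definition fixed :: "'a set" where
  "fixed = {z. cf (\<lambda>x y. x = z \<and> y = z)}"

text \<open>Composing the relation \<open>M x w = c\<close> with \<open>{z} \<times> UNIV\<close>
  yields the relation \<open>M x z = c\<close>, for every value \<open>c\<close>.\<close>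

lemma class_fun_fixed_col:
  assumes "cf M" "z \<in> fixed"
  shows "cf (\<lambda>x y. M x z)"
proof -
  have *: "cf (\<lambda>x y. M x z = c)" for c
  proof -
    have 1: "cf (\<lambda>x w. M x w = c)" using assms(1) by (rule class_fun_comp)
    have 2: "cf (\<lambda>w y. \<exists>u. (w = z \<and> u = z) \<and> True)"
      by (rule class_fun_ex) (use assms(2) in \<open>auto simp: fixed_def class_fun_const\<close>)
    have "cf (\<lambda>x y. \<exists>w. M x w = c \<and> (\<exists>u. (w = z \<and> u = z) \<and> True))"
      by (rule class_fun_ex[OF 1 2])
    then show ?thesis by simp
  qed
  show ?thesis
  proof (rule class_funI)
    fix s x y x' y' assume "s \<in> snd Y" "(x, y) \<in> s" "(x', y') \<in> s"
    from class_funD[OF *[of "M x' z"] this] show "M x z = M x' z" by simp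
  qed
qed

lemma fixedI:
  assumes "cf (\<lambda>x y. P x)" "\<And>x. P x \<longleftrightarrow> x = z"
  shows "z \<in> fixed"
proof -
  have "cf (\<lambda>x y. P x \<and> x = y)" by (rule class_fun_comp2[OF assms(1) class_fun_eq])
  moreover have "(\<lambda>x y. P x \<and> x = y) = (\<lambda>x y. x = z \<and> y = z)"
    using assms(2) by (intro ext) blast
  ultimately show ?thesis unfolding fixed_def by simp
qed

definition definable :: "'a set \<Rightarrow> bool" where
  "definable A \<longleftrightarrow> cf (\<lambda>x y. x \<in> A \<and> x = y)"

lemma definable_singleton:
  assumes "definable {z}"
  shows "z \<in> fixed"
proof -
  have "(\<lambda>x y. x \<in> {z} \<and> x = y) = (\<lambda>x y. x = z \<and> y = z)" by (intro ext) auto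
  with assms show ?thesis unfolding fixed_def definable_def by simp
qed

lemma definable_diff:
  assumes "definable A" "definable B"
  shows "definable (A - B)"
proof -
  have "cf (\<lambda>x y. (x \<in> A \<and> x = y) \<and> \<not> (x \<in> B \<and> x = y))"
    by (rule class_fun_comp2[OF assms[unfolded definable_def]])
  moreover have "(\<lambda>x y. (x \<in> A \<and> x = y) \<and> \<not> (x \<in> B \<and> x = y)) = (\<lambda>x y. x \<in> A - B \<and> x = y)"
    by (intro ext) auto
  ultimately show ?thesis unfolding definable_def by simp
qed

text \<open>Restrict \<open>r\<close> on the right to \<open>A\<close>, then compose with the full
  relation, which leaves a condition on \<open>u\<close> alone. This is the device for splitting a
  union of fibers by an asymmetric relation.\<close>

lemma definable_domain:
  assumes "definable A" "cf r"
  shows "definable {u \<in> A. \<exists>v\<in>A. r u v}"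
proof -
  have 1: "cf (\<lambda>x y. \<exists>v. r x v \<and> (v \<in> A \<and> v = y))"
    by (rule class_fun_ex[OF assms(2) assms(1)[unfolded definable_def]])
  have 2: "cf (\<lambda>x y. \<exists>v. (\<exists>w. r x w \<and> (w \<in> A \<and> w = v)) \<and> True)"
    by (rule class_fun_ex[OF 1 class_fun_const])
  have "cf (\<lambda>x y. (x \<in> A \<and> x = y) \<and> (\<exists>v. (\<exists>w. r x w \<and> (w \<in> A \<and> w = v)) \<and> True))"
    by (rule class_fun_comp2[OF assms(1)[unfolded definable_def] 2])
  moreover have "(\<lambda>x y. (x \<in> A \<and> x = y) \<and> (\<exists>v. (\<exists>w. r x w \<and> (w \<in> A \<and> w = v)) \<and> True))
      = (\<lambda>x y. x \<in> {u \<in> A. \<exists>v\<in>A. r u v} \<and> x = y)" by (intro ext) auto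
  ultimately show ?thesis unfolding definable_def by simp
qed

lemma relations_iff: "R \<in> relations Y \<longleftrightarrow> cf (\<lambda>x y. (x, y) \<in> R)"
proof
  assume "R \<in> relations Y"
  then obtain T where T: "T \<subseteq> snd Y" "R = \<Union>T" unfolding relations_def by blast
  have "q \<in> R" if "s \<in> snd Y" "p \<in> s" "q \<in> s" "p \<in> R" for p q s
    using T that disjoint by blast
  then show "cf (\<lambda>x y. (x, y) \<in> R)" by (intro class_funI) blast
next
  assume c: "cf (\<lambda>x y. (x, y) \<in> R)"
  let ?T = "{s \<in> snd Y. s \<subseteq> R}"
  have "p \<in> \<Union>?T" if "p \<in> R" for p
  proof -
    obtain s where s: "s \<in> snd Y" "p \<in> s" using cover by blast
    then have "q \<in> R" if "q \<in> s" for q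
      using c \<open>p \<in> R\<close> that unfolding class_fun_def by (metis prod.collapse)
    then have "s \<subseteq> R" by blast
    with s show ?thesis by blast
  qed
  then have "R = \<Union>?T" by blast
  then show "R \<in> relations Y" unfolding relations_def by blast
qed

text \<open>The conditions \<open>u = x\<close> and \<open>v = y\<close> are constant on basic
  relations, so the basic relation of \<open>(x, y)\<close> contains no other pair.\<close>

lemma relations_UNIV_if_all_fixed:
  assumes "fixed = UNIV"
  shows "relations Y = UNIV"
proof -
  have "cf (\<lambda>x y. (x, y) \<in> R)" for R
  proof (rule class_funI)
    fix s x y x' y' assume s: "s \<in> snd Y" "(x, y) \<in> s" "(x', y') \<in> s"
    have 1: "cf (\<lambda>u v. u = x)" and "cf (\<lambda>u v. u = y)"
      using class_fun_fixed_col[OF class_fun_eq] assms by auto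
    from class_fun_converse[OF this(2)] have 2: "cf (\<lambda>u v. v = y)" .
    have "x' = x" "y' = y" using class_funD[OF 1 s] class_funD[OF 2 s] by auto
    then show "((x, y) \<in> R) = ((x', y') \<in> R)" by simp
  qed
  then show ?thesis using relations_iff by blast
qed

lemma definable_union_of_fibers:
  assumes "union_of_fibers Y \<Delta>"
  shows "definable \<Delta>"
proof -
  obtain F where F: "F \<subseteq> fibers Y" "\<Delta> = \<Union>F" using assms unfolding union_of_fibers_def by blast
  have "Id_on \<Delta> = \<Union>(Id_on ` F)" unfolding F(2) by (auto simp: Id_on_def)
  moreover have "Id_on ` F \<subseteq> snd Y" using F(1) unfolding fibers_def by blast
  ultimately have "Id_on \<Delta> \<in> relations Y" unfolding relations_def by blast
  moreover have "(\<lambda>x y. (x, y) \<in> Id_on \<Delta>) = (\<lambda>x y. x \<in> \<Delta> \<and> x = y)" by (intro ext) (auto simp: Id_on_iff)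
  ultimately show ?thesis unfolding relations_iff definable_def by simp
qed

end

section \<open>Fissions of the Paley colouring\<close>

definition norm_poly :: "nat \<Rightarrow> nat \<Rightarrow> (nat \<Rightarrow> 'a) \<Rightarrow> 'a::comm_semiring_1 \<Rightarrow> 'a" where
  "norm_poly p d f t = (\<Sum>j<p. f j * t ^ j) ^ norm_exp p d"

lemma sum_lessThan_cubic:
  fixes t :: "'a::comm_semiring_1"
  assumes "p \<ge> 3" "\<And>j. j \<ge> 3 \<Longrightarrow> f j = 0"
  shows "(\<Sum>j<p. f j * t ^ j) = f 0 + f 1 * t + f 2 * t ^ 2"
proof -
  have "(\<Sum>j<p. f j * t ^ j) = (\<Sum>j<3. f j * t ^ j)"
    by (rule sum.mono_neutral_right) (use assms in auto)
  then show ?thesis by (simp add: eval_nat_numeral)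
qed

lemma sum_binomial_lessThan:
  fixes t :: "'a::comm_ring_1"
  assumes "k < p"
  shows "(\<Sum>j<p. (- 1) ^ j * of_nat (k choose j) * t ^ j) = (1 - t) ^ k"
proof -
  have "(1 - t) ^ k = (- t + 1) ^ k" by simp
  also have "\<dots> = (\<Sum>j\<le>k. of_nat (k choose j) * (- t) ^ j * 1 ^ (k - j))"
    by (rule binomial_ring)
  also have "\<dots> = (\<Sum>j\<le>k. (- 1) ^ j * of_nat (k choose j) * t ^ j)"
    by (intro sum.cong refl) (simp add: power_minus[of t])
  also have "\<dots> = (\<Sum>j<p. (- 1) ^ j * of_nat (k choose j) * t ^ j)"
    by (rule sum.mono_neutral_left) (use assms in \<open>auto simp: binomial_eq_0 not_le\<close>)
  finally show ?thesis by simp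
qed

text \<open>Fermat's little theorem in the prime field, by induction with the freshman's
  dream.\<close>

lemma of_nat_power_CHAR_minus_1:
  fixes c :: nat
  assumes "prime CHAR('a::idom)" "\<not> CHAR('a) dvd c"
  shows "(of_nat c :: 'a) ^ (CHAR('a) - 1) = 1"
proof -
  have "(of_nat n :: 'a) ^ CHAR('a) = of_nat n" for n
  proof (induction n)
    case 0
    then show ?case using assms(1) prime_gt_0_nat by simp
  next
    case (Suc n)
    then show ?case using freshmans_dream[OF assms(1) refl, of 1 "of_nat n"] by simp
  qed
  then have "(of_nat c :: 'a) * of_nat c ^ (CHAR('a) - 1) = of_nat c"
    using power_minus_mult[of "CHAR('a)" "of_nat c :: 'a"] assms(1) prime_gt_0_nat
    by (simp add: mult.commute)
  moreover have "(of_nat c :: 'a) \<noteq> 0" using assms(2) by (simp add: of_nat_eq_0_iff_char_dvd)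
  ultimately show ?thesis by simp
qed

text \<open>\<open>paley\<close> retains from the scheme the quadratic character of differences. Its
  exponent equals \<open>k * e\<close>, so it is the norm of \<open>(x - y) ^ k\<close>, a
  polynomial of degree below \<open>p\<close> to which the convolution formula applies.\<close>

locale paley_fission = coherent_on_UNIV Y for Y :: "'a::{finite,field} config" +
  fixes p d e k :: nat
  assumes odd_char: "(2::'a) \<noteq> 0"
    and p_def: "p = CHAR('a)" and q: "CARD('a) = p ^ d" and e_def: "e = norm_exp p d"
    and k_def: "k = (p - 1) div 2"
    and paley: "cf (\<lambda>x y. (x - y) ^ ((CARD('a) - 1) div 2))"
begin

lemma prime_p: "prime p"
  using prime_CHAR_finite_field[where 'a = 'a] p_def by simp

lemma p_ge_3: "p \<ge> 3"
proof -
  have "p \<noteq> 2"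
  proof
    assume "p = 2"
    then have "of_nat 2 = (0::'a)" using of_nat_CHAR[where 'a = 'a] p_def by metis
    then show False using odd_char by simp
  qed
  with prime_ge_2_nat[OF prime_p] show ?thesis by simp
qed

lemma p_eq: "p = 2 * k + 1"
proof -
  have "odd p" using prime_p p_ge_3 prime_odd_nat by auto
  then show ?thesis using k_def by (metis add_diff_cancel_right' nonzero_mult_div_cancel_left oddE zero_neq_numeral)
qed

lemma k_pos: "k > 0" using p_eq p_ge_3 by simp

lemma d_pos: "d > 0"
proof (rule ccontr)
  assume "\<not> d > 0"
  then have "CARD('a) = 1" using q by simp
  moreover have "CARD('a) \<ge> 2" using card_mono[of UNIV "{0, 1::'a}"] by simp
  ultimately show False by simp
qed

lemma e_pos: "e > 0"
  using d_pos by (cases d) (auto simp: e_def norm_exp_def lessThan_Suc_eq_insert_0)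

lemma e_mult: "(p - 1) * e = CARD('a) - 1"
proof -
  have "(p - 1) * norm_exp p d = p ^ d - 1" for d
  proof (induction d)
    case (Suc d)
    have "(p - 1) * norm_exp p (Suc d) = (p ^ d - 1) + (p - 1) * p ^ d"
      using Suc by (simp add: norm_exp_def algebra_simps)
    also have "\<dots> = p ^ Suc d - 1" using p_ge_3 by (cases p) (auto simp: algebra_simps)
    finally show ?case .
  qed (simp add: norm_exp_def)
  then show ?thesis using q e_def by simp
qed

lemma k_mult: "k * e = (CARD('a) - 1) div 2"
  using e_mult p_eq by (metis add_diff_cancel_right' mult.assoc nonzero_mult_div_cancel_left zero_neq_numeral)

lemma paley': "cf (\<lambda>x y. (x - y) ^ (k * e))"
  using paley k_mult by simp

lemma norm_power_p_minus_1: "x \<noteq> 0 \<Longrightarrow> (x::'a) ^ (e * (p - 1)) = 1"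
  using finite_field_power_card_minus_1[of x] e_mult by (simp add: mult.commute)

text \<open>The ratio is taken with origin \<open>z0\<close>. The default 0 at \<open>z0\<close>
  removes that point from matrix products, which thereby become convolutions over the multiplicative
  group.\<close>

definition quot_fun :: "'a \<Rightarrow> ('a \<Rightarrow> 'a) \<Rightarrow> 'a \<Rightarrow> 'a \<Rightarrow> 'a" where
  "quot_fun z0 \<phi> x y = (if x \<noteq> z0 \<and> y \<noteq> z0 then \<phi> ((x - z0) / (y - z0)) else 0)"

section \<open>Functions of the ratio relative to a singleton fiber\<close>

context
  fixes z0 :: 'a
  assumes z0: "z0 \<in> fixed"
begin

abbreviation "qf \<phi> \<equiv> cf (quot_fun z0 \<phi>)"

lemma class_fun_neq_left: "cf (\<lambda>x y. x \<noteq> z0)"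
  using class_fun_comp[OF class_fun_fixed_col[OF class_fun_eq z0], of Not] .

lemma class_fun_neq: "cf (\<lambda>x y. x \<noteq> z0 \<and> y \<noteq> z0)"
  using class_fun_comp2[OF class_fun_neq_left class_fun_converse[OF class_fun_neq_left]] .

lemma qf_cong:
  assumes "qf \<phi>" "\<And>t. t \<noteq> 0 \<Longrightarrow> \<phi> t = \<psi> t"
  shows "qf \<psi>"
proof -
  have "quot_fun z0 \<phi> = quot_fun z0 \<psi>"
    unfolding quot_fun_def using assms(2) by (intro ext) auto
  with assms(1) show ?thesis by simp
qed

lemma qf_comp2:
  assumes "qf \<phi>" "qf \<psi>"
  shows "qf (\<lambda>t. h (\<phi> t) (\<psi> t))"
proof -
  have "cf (\<lambda>x y. if x \<noteq> z0 \<and> y \<noteq> z0 then h (quot_fun z0 \<phi> x y) (quot_fun z0 \<psi> x y) else 0)"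
    using class_fun_comp2[OF class_fun_neq class_fun_comp2[OF assms, of h], of "\<lambda>c v. if c then v else 0"] .
  moreover have "(\<lambda>x y. if x \<noteq> z0 \<and> y \<noteq> z0 then h (quot_fun z0 \<phi> x y) (quot_fun z0 \<psi> x y) else 0)
      = quot_fun z0 (\<lambda>t. h (\<phi> t) (\<psi> t))"
    by (intro ext) (simp add: quot_fun_def)
  ultimately show ?thesis by simp
qed

lemma qf_comp: "qf \<phi> \<Longrightarrow> qf (\<lambda>t. h (\<phi> t))"
  using qf_comp2[of \<phi> \<phi> "\<lambda>u v. h u"] by simp

text \<open>This is the matrix product of the two quotient functions: substituting
  \<open>y = z0 + s * (z - z0)\<close> splits the ratio \<open>t\<close> of \<open>x\<close> and
  \<open>z\<close> into \<open>t / s\<close> and \<open>s\<close>.\<close>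

lemma qf_convolution:
  assumes "qf \<phi>" "qf \<psi>"
  shows "qf (\<lambda>t. \<Sum>s\<in>UNIV-{0}. \<phi> (t / s) * \<psi> s)"
proof -
  have "quot_fun z0 (\<lambda>t. \<Sum>s\<in>UNIV-{0}. \<phi> (t / s) * \<psi> s) x z
      = (\<Sum>y\<in>UNIV. quot_fun z0 \<phi> x y * quot_fun z0 \<psi> y z)" for x z
  proof (cases "x \<noteq> z0 \<and> z \<noteq> z0")
    case True
    have "(\<Sum>y\<in>UNIV. quot_fun z0 \<phi> x y * quot_fun z0 \<psi> y z)
        = (\<Sum>y\<in>UNIV-{z0}. quot_fun z0 \<phi> x y * quot_fun z0 \<psi> y z)"
      by (rule sum.mono_neutral_right) (auto simp: quot_fun_def)
    also have "\<dots> = (\<Sum>s\<in>UNIV-{0}. \<phi> ((x - z0) / (z - z0) / s) * \<psi> s)"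
      by (rule sum.reindex_bij_witness[of _ "\<lambda>s. s * (z - z0) + z0" "\<lambda>y. (y - z0) / (z - z0)"])
        (use True in \<open>auto simp: quot_fun_def\<close>)
    finally show ?thesis using True by (simp add: quot_fun_def)
  qed (auto simp: quot_fun_def)
  then show ?thesis
    using class_fun_sum[OF assms, of "(*)"] by presburger
qed

lemma qf_norm_poly_mult:
  assumes "qf (norm_poly p d f)" "qf (norm_poly p d g)" "f (p - 1) = 0"
  shows "qf (norm_poly p d (\<lambda>j. f j * g j))"
proof -
  let ?c = "(f 0 * g (p - 1)) ^ norm_exp p d"
  have "qf (\<lambda>t. - (\<Sum>s\<in>UNIV-{0}. norm_poly p d f (t / s) * norm_poly p d g s) - ?c)"
    by (rule qf_comp[OF qf_convolution[OF assms(1,2)], of "\<lambda>u. - u - ?c"])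
  then show ?thesis
    by (rule qf_cong) (simp add: norm_poly_def norm_poly_convolution[where f = f, OF p_def q assms(3)])
qed

text \<open>\<open>1 - t\<close> is the ratio of \<open>y - x\<close> and \<open>y - z0\<close>; the
  character of the latter is a column of the Paley colouring at the fixed point
  \<open>z0\<close>.\<close>

lemma qf_paley: "qf (\<lambda>t. (1 - t) ^ (k * e))"
proof -
  have 1: "cf (\<lambda>x y. (y - x) ^ (k * e))" by (rule class_fun_converse[OF paley'])
  have 2: "cf (\<lambda>x y. (y - z0) ^ (k * e))"
    by (rule class_fun_converse[OF class_fun_fixed_col[OF paley' z0]])
  have "cf (\<lambda>x y. if x \<noteq> z0 \<and> y \<noteq> z0 then (y - x) ^ (k * e) / (y - z0) ^ (k * e) else 0)"
    using class_fun_comp2[OF class_fun_neq class_fun_comp2[OF 1 2, of "(/)"], of "\<lambda>c v. if c then v else 0"] .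
  moreover have "(if x \<noteq> z0 \<and> y \<noteq> z0 then (y - x) ^ (k * e) / (y - z0) ^ (k * e) else 0)
      = quot_fun z0 (\<lambda>t. (1 - t) ^ (k * e)) x y" for x y
  proof (cases "x \<noteq> z0 \<and> y \<noteq> z0")
    case True
    then have "1 - (x - z0) / (y - z0) = (y - x) / (y - z0)" by (simp add: field_simps)
    with True show ?thesis by (simp add: quot_fun_def power_divide)
  qed (auto simp: quot_fun_def)
  ultimately show ?thesis by simp
qed

text \<open>
  Convolution powers of \<open>N ((1 - t) ^ k)\<close> raise the binomial coefficients, nonzero elements of the prime
  field, to the power \<open>p - 1\<close>.
\<close>
lemma qf_norm_truncated_geometric: "qf (norm_poly p d (\<lambda>j. of_bool (j \<le> k)))"
proof -
  let ?f = "\<lambda>j. (- 1) ^ j * of_nat (k choose j) :: 'a"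
  have kp: "k < p" "k < p - 1" using p_eq k_pos by auto
  have f_top: "?f (p - 1) = 0" using kp by (simp add: binomial_eq_0)
  have base: "qf (norm_poly p d ?f)"
    using qf_paley by (rule qf_cong) (simp add: norm_poly_def sum_binomial_lessThan[OF kp(1)] e_def power_mult)
  have "qf (norm_poly p d (\<lambda>j. ?f j ^ Suc n))" for n
  proof (induction n)
    case (Suc n)
    from qf_norm_poly_mult[OF base this f_top] show ?case by (simp only: power_Suc)
  qed (use base in simp)
  moreover have "p - 1 = Suc (p - 2)" using p_ge_3 by simp
  ultimately have "qf (norm_poly p d (\<lambda>j. ?f j ^ (p - 1)))" by metis
  moreover have "?f j ^ (p - 1) = of_bool (j \<le> k)" for j
  proof (cases "j \<le> k")
    case True
    have "\<not> p dvd (k choose j)"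
    proof
      assume "p dvd (k choose j)"
      also have "(k choose j) dvd fact k"
        using True by (metis binomial_fact_lemma dvd_triv_right)
      finally show False using kp(1) prime_p by (simp add: prime_dvd_fact_iff)
    qed
    then have "of_nat (k choose j) ^ (p - 1) = (1::'a)"
      using of_nat_power_CHAR_minus_1[where 'a = 'a] prime_p p_def by simp
    moreover have "((- 1) ^ j) ^ (p - 1) = (1::'a)"
      using p_eq by (simp add: power_mult[symmetric])
    ultimately show ?thesis using True by (simp add: power_mult_distrib)
  qed (use kp in \<open>simp add: binomial_eq_0 zero_power\<close>)
  ultimately show ?thesis by simp
qed

text \<open>
  Pointwise, \<open>N (1 + t + \<dots> + t ^ k) * N ((1 - t) ^ k) = N ((1 - t ^ (k + 1)) * (1 - t) ^ (k - 1))\<close>;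
  convolving with \<open>N (1 + t + \<dots> + t ^ k)\<close> truncates at degree \<open>k\<close> and leaves \<open>N ((1 - t) ^ (k - 1))\<close>.
  Together with \<open>N ((1 - t) ^ k)\<close> this gives \<open>N (1 - t) ^ (p - 2)\<close>, the inverse of \<open>N (1 - t)\<close>.
\<close>
lemma qf_norm: "qf (\<lambda>t. (1 - t) ^ e)"
proof -
  let ?I = "\<lambda>j. of_bool (j \<le> k) :: 'a"
  let ?b = "\<lambda>j. (- 1) ^ j * of_nat (k - 1 choose j) :: 'a"
  \<comment> \<open>Coefficients of \<open>(1 - t ^ (k + 1)) * (1 - t) ^ (k - 1)\<close>: the two
    copies of \<open>?b\<close> do not overlap, and since \<open>p = 2 * k + 1\<close> the upper one
    ends at degree \<open>p - 1\<close>.\<close>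
  let ?g = "\<lambda>j. if j \<le> k then ?b j else - ?b (j - Suc k)"
  have kp: "k < p" "k < p - 1" using p_eq k_pos by auto
  have b_sum: "(\<Sum>j<k. ?b j * t ^ j) = (1 - t) ^ (k - 1)" for t
    by (rule sum_binomial_lessThan) (use k_pos in simp)
  have prod: "(\<Sum>j<p. ?I j * t ^ j) * (1 - t) ^ k = (\<Sum>j<p. ?g j * t ^ j)" for t
  proof -
    have "(\<Sum>j<p. ?I j * t ^ j) = (\<Sum>j<Suc k. t ^ j)"
      by (rule sum.mono_neutral_cong_right) (use kp in auto)
    then have "(\<Sum>j<p. ?I j * t ^ j) * (1 - t) ^ k = ((1 - t) * (\<Sum>j<Suc k. t ^ j)) * (1 - t) ^ (k - 1)"
      using k_pos by (cases k) (simp_all add: mult_ac)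
    also have "(1 - t) * (\<Sum>j<Suc k. t ^ j) = 1 - t ^ Suc k"
      by (rule one_diff_power_eq[symmetric])
    also have "(1 - t ^ Suc k) * (1 - t) ^ (k - 1) = (\<Sum>j<k. ?b j * t ^ j) - (\<Sum>j<k. ?b j * t ^ (j + Suc k))"
      unfolding power_add mult.assoc[symmetric] sum_distrib_right[symmetric] b_sum
      by (simp add: algebra_simps)
    also have "(\<Sum>j<k. ?b j * t ^ j) = (\<Sum>j<Suc k. ?g j * t ^ j)"
      using k_pos by (simp add: binomial_eq_0)
    also have "(\<Sum>j<k. ?b j * t ^ (j + Suc k)) = - (\<Sum>j\<in>{Suc k..<p}. ?g j * t ^ j)"
      unfolding sum_negf[symmetric]
      by (rule sum.reindex_bij_witness[of _ "\<lambda>j. j - Suc k" "\<lambda>j. j + Suc k"]) (use p_eq in auto)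
    also have "(\<Sum>j<Suc k. ?g j * t ^ j) - - (\<Sum>j\<in>{Suc k..<p}. ?g j * t ^ j) = (\<Sum>j<p. ?g j * t ^ j)"
      unfolding lessThan_atLeast0 diff_minus_eq_add
      by (rule sum.atLeastLessThan_concat) (use kp in simp_all)
    finally show ?thesis .
  qed
  have "qf (\<lambda>t. norm_poly p d ?I t * (1 - t) ^ (k * e))"
    by (rule qf_comp2[OF qf_norm_truncated_geometric qf_paley])
  then have "qf (norm_poly p d ?g)"
    by (rule qf_cong) (simp only: norm_poly_def e_def prod[symmetric] power_mult power_mult_distrib)
  from qf_norm_poly_mult[OF qf_norm_truncated_geometric this] kp
  have "qf (norm_poly p d (\<lambda>j. ?I j * ?g j))" by simp
  also have "(\<lambda>j. ?I j * ?g j) = ?b"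
    by (intro ext) (use k_pos in \<open>auto simp: binomial_eq_0\<close>)
  finally have "qf (\<lambda>t. (1 - t) ^ ((k - 1) * e))"
    by (rule qf_cong) (use kp in \<open>simp add: norm_poly_def sum_binomial_lessThan e_def power_mult\<close>)
  \<comment> \<open>The product \<open>u * v\<close> is the norm of \<open>1 - t\<close> to the
    power \<open>p - 2\<close>; the outer power restores the norm because
    \<open>(p - 2) * (p - 2)\<close> is 1 modulo \<open>p - 1\<close>.\<close>
  from qf_comp2[OF this qf_paley, of "\<lambda>u v. (u * v) ^ (p - 2)"]
  show ?thesis
  proof (rule qf_cong)
    fix t :: 'a
    have "((1 - t) ^ ((k - 1) * e) * (1 - t) ^ (k * e)) ^ (p - 2) = (1 - t) ^ ((k - 1 + k) * e * (p - 2))"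
      by (simp only: power_add[symmetric] power_mult[symmetric] add_mult_distrib)
    also have "k - 1 + k = p - 2" using p_eq k_pos by simp
    also have "(p - 2) * e * (p - 2) = e * (p - 1) * (p - 3) + e"
    proof -
      obtain r where "p = r + 3" using p_ge_3 by (metis add.commute le_Suc_ex)
      then show ?thesis by (simp add: algebra_simps)
    qed
    also have "(1 - t) ^ (e * (p - 1) * (p - 3) + e) = (1 - t) ^ e"
    proof (cases "1 - t = 0")
      case True
      then show ?thesis using e_pos by (simp add: zero_power)
    next
      case False
      then show ?thesis using norm_power_p_minus_1[of "1 - t"] by (simp add: power_add power_mult)
    qed
    finally show "((1 - t) ^ ((k - 1) * e) * (1 - t) ^ (k * e)) ^ (p - 2) = (1 - t) ^ e" .
  qed
qed

section \<open>New singleton fibers from given ones\<close>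

lemma class_fun_norm_diff:
  assumes "z \<in> fixed" "z \<noteq> z0"
  shows "cf (\<lambda>y w. if y \<noteq> z0 then (z - y) ^ e else 0)"
proof -
  have "cf (\<lambda>y w. quot_fun z0 (\<lambda>t. (1 - t) ^ e) y z * (z - z0) ^ e)"
    using class_fun_comp[OF class_fun_fixed_col[OF qf_norm assms(1)], of "\<lambda>u. u * (z - z0) ^ e"] .
  moreover have "quot_fun z0 (\<lambda>t. (1 - t) ^ e) y z * (z - z0) ^ e = (if y \<noteq> z0 then (z - y) ^ e else 0)" for y
  proof -
    have "(1 - (y - z0) / (z - z0)) * (z - z0) = z - y" using assms(2) by (simp add: field_simps)
    then show ?thesis using assms(2) by (simp add: quot_fun_def flip: power_mult_distrib)
  qed
  ultimately show ?thesis by simp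
qed

text \<open>Convolution with the norm of \<open>1 - t\<close> multiplies the coefficients of
  \<open>g\<close> by 1, -1, 0, 0 and so on. Up to sign and the constant \<open>?c\<close> this
  leaves the norm of \<open>g 0 - g 1 * (x - z0)\<close>, which vanishes only where its argument
  does.\<close>

lemma class_fun_linear_part:
  assumes "cf (\<lambda>y w. if y \<noteq> z0 then norm_poly p d g (y - z0) else 0)"
  shows "cf (\<lambda>x w. x \<noteq> z0 \<and> g 0 = g 1 * (x - z0))"
proof -
  let ?G = "\<lambda>y. if y \<noteq> z0 then norm_poly p d g (y - z0) else 0"
  let ?f = "\<lambda>j::nat. if j = 0 then 1 else if j = 1 then - 1 else 0 :: 'a"
  let ?c = "(?f 0 * g (p - 1)) ^ norm_exp p d"
  have f: "norm_poly p d ?f t = (1 - t) ^ e" for t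
    unfolding norm_poly_def e_def by (subst sum_lessThan_cubic[OF p_ge_3]) auto
  have sum: "(\<Sum>y\<in>UNIV. quot_fun z0 (\<lambda>t. (1 - t) ^ e) x y * ?G y) = - ((g 0 - g 1 * (x - z0)) ^ e + ?c)"
    if "x \<noteq> z0" for x
  proof -
    have "(\<Sum>y\<in>UNIV. quot_fun z0 (\<lambda>t. (1 - t) ^ e) x y * ?G y)
        = (\<Sum>y\<in>UNIV-{z0}. norm_poly p d ?f ((x - z0) / (y - z0)) * norm_poly p d g (y - z0))"
      unfolding f by (rule sum.mono_neutral_cong_right) (use that in \<open>auto simp: quot_fun_def\<close>)
    also have "\<dots> = (\<Sum>s\<in>UNIV-{0}. norm_poly p d ?f ((x - z0) / s) * norm_poly p d g s)"
      by (rule sum.reindex_bij_witness[of _ "\<lambda>s. s + z0" "\<lambda>y. y - z0"]) auto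
    also have "\<dots> = - ((\<Sum>j<p. ?f j * g j * (x - z0) ^ j) ^ norm_exp p d + ?c)"
      unfolding norm_poly_def by (rule norm_poly_convolution[OF p_def q]) (use p_ge_3 that in auto)
    also have "(\<Sum>j<p. ?f j * g j * (x - z0) ^ j) = g 0 - g 1 * (x - z0)"
      by (subst sum_lessThan_cubic[OF p_ge_3]) auto
    finally show ?thesis by (simp add: e_def)
  qed
  have "cf (\<lambda>x w. \<Sum>y\<in>UNIV. quot_fun z0 (\<lambda>t. (1 - t) ^ e) x y * ?G y)"
    using class_fun_sum[OF qf_norm assms, of "(*)"] .
  from class_fun_comp2[OF class_fun_neq_left this, of "\<lambda>c u. c \<and> - u - ?c = 0"]
  have "cf (\<lambda>x w. x \<noteq> z0 \<and> - (\<Sum>y\<in>UNIV. quot_fun z0 (\<lambda>t. (1 - t) ^ e) x y * ?G y) - ?c = 0)" .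
  moreover have "(x \<noteq> z0 \<and> - (\<Sum>y\<in>UNIV. quot_fun z0 (\<lambda>t. (1 - t) ^ e) x y * ?G y) - ?c = 0)
      \<longleftrightarrow> x \<noteq> z0 \<and> g 0 = g 1 * (x - z0)" for x
    using sum[of x] e_pos by (cases "x = z0") auto
  ultimately show ?thesis by simp
qed

text \<open>In \<open>t = y - z0\<close> the polynomial \<open>z - y\<close> is
  \<open>(z - z0) - t\<close>. Its linear coefficient changes sign, and \<open>(z - z0) + t\<close>
  vanishes at the reflected point.\<close>

lemma fixed_reflect:
  assumes "z \<in> fixed"
  shows "2 * z0 - z \<in> fixed"
proof (cases "z = z0")
  case False
  let ?g = "\<lambda>j::nat. if j = 0 then z - z0 else if j = 1 then - 1 else 0 :: 'a"
  have g: "norm_poly p d ?g (y - z0) = (z - y) ^ e" for y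
    unfolding norm_poly_def e_def by (subst sum_lessThan_cubic[OF p_ge_3]) auto
  have "cf (\<lambda>x w. x \<noteq> z0 \<and> ?g 0 = ?g 1 * (x - z0))"
    by (rule class_fun_linear_part) (unfold g, rule class_fun_norm_diff[OF assms False])
  then show ?thesis
    by (rule fixedI) (use False in \<open>auto simp: algebra_simps\<close>)
qed (use z0 in simp)

text \<open>In \<open>t = y - z0\<close> the product \<open>(z - y) * (w - y)\<close> is
  \<open>u * v - (u + v) * t + t ^ 2\<close>. Dropping the square and changing the sign of the
  linear term gives \<open>u * v + (u + v) * t\<close>, whose zero is the new point.\<close>

lemma fixed_harmonic:
  assumes z: "z \<in> fixed" "z \<noteq> z0" and w: "w \<in> fixed" "w \<noteq> z0" and sum: "z - z0 + (w - z0) \<noteq> 0"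
  shows "z0 - (z - z0) * (w - z0) / (z - z0 + (w - z0)) \<in> fixed"
proof -
  define u where "u = z - z0"
  define v where "v = w - z0"
  have uv: "u \<noteq> 0" "v \<noteq> 0" "u + v \<noteq> 0" using assms by (auto simp: u_def v_def)
  let ?g = "\<lambda>j::nat. if j = 0 then u * v else if j = 1 then - (u + v) else if j = 2 then 1 else 0 :: 'a"
  have g: "norm_poly p d ?g (y - z0) = (z - y) ^ e * (w - y) ^ e" for y
  proof -
    have "norm_poly p d ?g (y - z0) = (u * v + - (u + v) * (y - z0) + 1 * (y - z0) ^ 2) ^ e"
      unfolding norm_poly_def e_def by (subst sum_lessThan_cubic[OF p_ge_3]) auto
    also have "u * v + - (u + v) * (y - z0) + 1 * (y - z0) ^ 2 = (z - y) * (w - y)"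
      by (simp add: u_def v_def algebra_simps power2_eq_square)
    finally show ?thesis by (simp add: power_mult_distrib)
  qed
  have eq: "(if y \<noteq> z0 then (z - y) ^ e else 0) * (if y \<noteq> z0 then (w - y) ^ e else 0)
      = (if y \<noteq> z0 then (z - y) ^ e * (w - y) ^ e else 0)" for y by simp
  have "cf (\<lambda>y w'. if y \<noteq> z0 then (z - y) ^ e * (w - y) ^ e else 0)"
    using class_fun_comp2[OF class_fun_norm_diff[OF z] class_fun_norm_diff[OF w], of "(*)"]
    unfolding eq .
  then have "cf (\<lambda>x w. x \<noteq> z0 \<and> ?g 0 = ?g 1 * (x - z0))"
    by (intro class_fun_linear_part) (unfold g)
  then have "z0 - u * v / (u + v) \<in> fixed"
  proof (rule fixedI)
    fix x
    have "u * v = - (u + v) * (x - z0) \<longleftrightarrow> x = z0 - u * v / (u + v)"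
      using uv(3) by (auto simp: field_simps) 
    moreover have "z0 - u * v / (u + v) \<noteq> z0" using uv by simp
    ultimately show "x \<noteq> z0 \<and> ?g 0 = ?g 1 * (x - z0) \<longleftrightarrow> x = z0 - u * v / (u + v)" by auto
  qed
  then show ?thesis by (simp add: u_def v_def)
qed

end

end

section \<open>Bases of cyclotomic schemes\<close>

text \<open>Reflections give addition in odd characteristic, the harmonic operation gives inverses,
  a partial fraction identity gives squares, and polarization gives products. Hence \<open>Z\<close>
  contains all powers of \<open>g\<close>.\<close>

lemma reflection_harmonic_closed_eq_UNIV:
  fixes Z :: "'a::{finite,field} set"
  assumes odd: "(2::'a) \<noteq> 0" and one: "1 \<in> Z" and zero: "0 \<in> Z"
    and reflect: "\<And>a z. a \<in> Z \<Longrightarrow> z \<in> Z \<Longrightarrow> 2 * a - z \<in> Z"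
    and harmonic: "\<And>z w. z \<in> Z \<Longrightarrow> w \<in> Z \<Longrightarrow> z \<noteq> 0 \<Longrightarrow> w \<noteq> 0 \<Longrightarrow> z + w \<noteq> 0 \<Longrightarrow> - (z * w / (z + w)) \<in> Z"
    and gen: "g \<in> Z" "\<And>x. x \<noteq> 0 \<Longrightarrow> \<exists>i::nat. x = g ^ i"
  shows "Z = UNIV"
proof -
  have neg: "- z \<in> Z" if "z \<in> Z" for z using reflect[OF zero that] by simp
  have shift: "z + of_nat n * (2 * a) \<in> Z" if "z \<in> Z" "a \<in> Z" for z a and n :: nat
  proof (induction n)
    case (Suc n)
    from reflect[OF that(2) neg[OF Suc]] show ?case by (simp add: algebra_simps)
  qed (use that in simp)
  have "CHAR('a) \<noteq> 2"
  proof
    assume "CHAR('a) = 2"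
    then have "of_nat 2 = (0::'a)" using of_nat_CHAR[where 'a = 'a] by metis
    then show False using odd by simp
  qed
  then have "odd CHAR('a)"
    using prime_CHAR_finite_field[where 'a = 'a] by (metis primes_dvd_imp_eq two_is_prime_nat)
  then obtain m where m: "CHAR('a) = 2 * m + 1" by (rule oddE)
  \<comment> \<open>\<open>m + 1\<close> represents one half, so that many shifts by
    \<open>2 * a\<close> add \<open>a\<close>.\<close>
  have half: "of_nat (m + 1) * 2 = (1::'a)"
  proof -
    have "of_nat (m + 1) * 2 = (of_nat (2 * m + 1) + 1 :: 'a)" by simp
    also have "of_nat (2 * m + 1) = (0::'a)" unfolding m[symmetric] by simp
    finally show ?thesis by simp
  qed
  have add: "z + a \<in> Z" if "z \<in> Z" "a \<in> Z" for z a
    using shift[OF that, of "m + 1"] half by (simp only: mult.assoc[symmetric] mult_1_left)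
  have diff: "z - a \<in> Z" if "z \<in> Z" "a \<in> Z" for z a
    using add[OF that(1) neg[OF that(2)]] by simp
  have inv: "inverse u \<in> Z" if "u \<in> Z" "u \<noteq> 0" for u
  proof (cases "u = 1")
    case False
    \<comment> \<open>The harmonic operation on \<open>u - 1\<close> and 1 produces
      \<open>1 / u - 1\<close>.\<close>
    have "- ((u - 1) * 1 / (u - 1 + 1)) \<in> Z"
      by (rule harmonic[OF diff[OF that(1) one] one]) (use False that in auto)
    also have "- ((u - 1) * 1 / (u - 1 + 1)) = inverse u - 1" using that(2) by (simp add: field_simps)
    finally show ?thesis using add[OF _ one] by fastforce
  qed (use one in simp)
  have sq: "a * a \<in> Z" if "a \<in> Z" for a
  proof (cases "a = 0 \<or> a = 1")
    case False
    then have nz: "a \<noteq> 0" "1 - a \<noteq> 0" by auto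
    \<comment> \<open>Partial fractions of \<open>1 / (a * (1 - a))\<close>: a further inversion
      reaches \<open>a - a * a\<close> without using products.\<close>
    have "inverse a + inverse (1 - a) \<in> Z"
      by (intro add inv diff one that nz)
    also have "inverse a + inverse (1 - a) = inverse (a - a * a)"
      using nz by (simp add: field_simps)
    finally have inv_mem: "inverse (a - a * a) \<in> Z" .
    have "a - a * a = a * (1 - a)" by (simp add: algebra_simps)
    then have "a - a * a \<noteq> 0" using nz by simp
    with inv[OF inv_mem] have "a - a * a \<in> Z" by simp
    from diff[OF that this] show ?thesis by simp
  qed (use that in auto)
  have scale: "of_nat n * z \<in> Z" if "z \<in> Z" for n z
    by (induction n) (use zero add that in \<open>auto simp: algebra_simps\<close>)
  have mult: "a * c \<in> Z" if "a \<in> Z" "c \<in> Z" for a c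
  proof -
    have "(a + c) * (a + c) - a * a - c * c \<in> Z" by (intro diff sq add that)
    also have "(a + c) * (a + c) - a * a - c * c = 2 * (a * c)" by (simp add: algebra_simps)
    finally have "of_nat (m + 1) * (2 * (a * c)) \<in> Z" by (rule scale)
    then show ?thesis using half by (simp only: mult.assoc[symmetric] mult_1_left)
  qed
  have "g ^ i \<in> Z" for i
    by (induction i) (use one mult gen(1) in auto)
  then show ?thesis using gen(2) zero by (metis UNIV_eq_I)
qed

lemma (in paley_fission) fixed_eq_UNIV:
  assumes "0 \<in> fixed" "1 \<in> fixed" "g \<in> fixed" "\<And>x. x \<noteq> 0 \<Longrightarrow> \<exists>i::nat. x = g ^ i"
  shows "fixed = UNIV"
proof (rule reflection_harmonic_closed_eq_UNIV[OF odd_char, where g = g])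
  show "2 * a - z \<in> fixed" if "a \<in> fixed" "z \<in> fixed" for a z
    using fixed_reflect that .
  show "- (z * w / (z + w)) \<in> fixed"
    if "z \<in> fixed" "w \<in> fixed" "z \<noteq> 0" "w \<noteq> 0" "z + w \<noteq> 0" for z w
    using fixed_harmonic[OF assms(1), of z w] that by simp
qed (use assms in auto)

section \<open>The discrete configuration and generalized bases\<close>

lemma is_fission_discrete:
  fixes X :: "'a::finite config"
  assumes "fst X = UNIV"
  shows "is_fission (UNIV, range (\<lambda>p. {p})) X" (is "is_fission ?D X")
proof -
  have rel: "relations ?D = UNIV"
  proof -
    have "R \<in> relations ?D" for R
      unfolding relations_def by (intro CollectI exI[of _ "(\<lambda>p. {p}) ` R"]) auto
    then show ?thesis by blast
  qed
  have "coherent_config ?D"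
    unfolding coherent_config_def prod.case
  proof (intro conjI)
    show "\<exists>T\<subseteq>range (\<lambda>p. {p}). \<Union>T = Id_on UNIV"
      by (intro exI[of _ "(\<lambda>p. {p}) ` Id"]) auto
  qed auto
  with rel assms show ?thesis unfolding is_fission_def by simp
qed

lemma union_of_fibers_discrete: "union_of_fibers (UNIV, range (\<lambda>p. {p})) \<Delta>"
proof -
  have "Id_on {x} = {(x, x)}" for x by auto
  then have "(\<lambda>x. {x}) ` \<Delta> \<subseteq> fibers (UNIV, range (\<lambda>p. {p}))"
    unfolding fibers_def by auto
  then show ?thesis unfolding union_of_fibers_def by (intro exI[of _ "(\<lambda>x. {x}) ` \<Delta>"]) auto
qed

text \<open>The discrete configuration is itself the fission sought: it is admissible, and by
  hypothesis every admissible fission has all relations and so refines it.\<close>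

lemma generalized_baseI:
  fixes X :: "'a::finite config"
  assumes "fst X = UNIV"
    and "\<And>Y. is_fission Y X \<Longrightarrow> \<forall>\<Delta>\<in>P. union_of_fibers Y \<Delta> \<Longrightarrow> relations Y = UNIV"
  shows "generalized_base X P"
  unfolding generalized_base_def
proof (intro conjI exI[of _ "(UNIV, range (\<lambda>p. {p}))"])
  show "P \<subseteq> Pow (fst X)" using assms(1) by simp
  show "complete_config (UNIV, range (\<lambda>p. {p}))" unfolding complete_config_def by auto
  show "is_Pi_fission X P (UNIV, range (\<lambda>p. {p}))"
    unfolding is_Pi_fission_def
  proof (intro conjI allI impI)
    fix Y' assume "is_fission Y' X \<and> (\<forall>\<Delta>\<in>P. union_of_fibers Y' \<Delta>)"
    moreover from this have "relations Y' = UNIV" using assms(2) by blast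
    ultimately show "is_fission Y' (UNIV, range (\<lambda>p. {p}))"
      using assms(1) by (simp add: is_fission_def)
  qed (intro is_fission_discrete[OF assms(1)] ballI union_of_fibers_discrete)+
qed

lemma class_fun_fission:
  assumes "is_fission Y X" "class_fun X M" "\<Union>(snd X) = UNIV" "coherent_config Y"
  shows "class_fun Y M"
proof (rule class_funI)
  fix s x y x' y' assume s: "s \<in> snd Y" "(x, y) \<in> s" "(x', y') \<in> s"
  obtain r where r: "r \<in> snd X" "(x, y) \<in> r" using assms(3) by blast
  have "r = \<Union>{r}" by simp
  then have "r \<in> relations X" using r(1) unfolding relations_def by blast
  then have "r \<in> relations Y" using assms(1) unfolding is_fission_def by blast
  then obtain T where T: "T \<subseteq> snd Y" "r = \<Union>T" unfolding relations_def by blast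
  then obtain t where t: "t \<in> T" "(x, y) \<in> t" using r(2) by blast
  have "\<forall>s\<in>snd Y. \<forall>t\<in>snd Y. s \<noteq> t \<longrightarrow> s \<inter> t = {}"
    using assms(4) unfolding coherent_config_def by (cases Y) simp
  then have "s = t" using s t T(1) by blast
  then have "(x', y') \<in> r" using s(3) t(1) T(2) by blast
  then show "M x y = M x' y'" using class_funD[OF assms(2) r] by blast
qed

section \<open>Basic relations of cyclotomic schemes\<close>

lemma snd_cyclotomic_scheme:
  "snd (cyclotomic_scheme K) = {{(a * x + c, a * y + c) | a c. a \<in> K} | x y. True}"
proof -
  have "{(g x, g y) | g. g \<in> affine_group_K K} = {(a * x + c, a * y + c) | a c. a \<in> K}" for x y
  proof (intro equalityI subsetI)
    fix z assume "z \<in> {(a * x + c, a * y + c) | a c. a \<in> K}"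
    then obtain a c where z: "z = (a * x + c, a * y + c)" "a \<in> K" by blast
    then have "(\<lambda>x. a * x + c) \<in> affine_group_K K" unfolding affine_group_K_def by blast
    with z(1) show "z \<in> {(g x, g y) | g. g \<in> affine_group_K K}"
      by (intro CollectI exI[of _ "\<lambda>x. a * x + c"]) simp
  qed (auto simp: affine_group_K_def)
  then show ?thesis unfolding cyclotomic_scheme_def Inv_def by simp
qed

lemma fst_cyclotomic_scheme: "fst (cyclotomic_scheme K) = UNIV"
  unfolding cyclotomic_scheme_def Inv_def by simp

lemma cyclotomic_scheme_cover:
  assumes "mult_subgroup K"
  shows "\<Union>(snd (cyclotomic_scheme K)) = UNIV"
proof -
  have "(x, y) \<in> \<Union>(snd (cyclotomic_scheme K))" for x y
  proof -
    have "(x, y) = (1 * x + 0, 1 * y + 0)" by simp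
    moreover have "1 \<in> K" using assms unfolding mult_subgroup_def by blast
    ultimately have "(x, y) \<in> {(a * x + c, a * y + c) | a c. a \<in> K}" by blast
    then show ?thesis unfolding snd_cyclotomic_scheme by blast
  qed
  then show ?thesis by auto
qed

lemma class_fun_cyclotomic:
  assumes "\<And>a u. a \<in> K \<Longrightarrow> h (a * u) = h u"
  shows "class_fun (cyclotomic_scheme K) (\<lambda>x y. h (x - y))"
proof (rule class_funI)
  fix s x y x' y'
  assume "s \<in> snd (cyclotomic_scheme K)" and xy: "(x, y) \<in> s" "(x', y') \<in> s"
  then obtain u v where s: "s = {(a * u + c, a * v + c) | a c. a \<in> K}"
    unfolding snd_cyclotomic_scheme by blast
  have "h (z - w) = h (u - v)" if zw: "(z, w) \<in> s" for z w
  proof -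
    obtain a c where "z = a * u + c" "w = a * v + c" "a \<in> K" using zw s by blast
    then have "z - w = a * (u - v)" by (simp add: algebra_simps)
    then show ?thesis using assms \<open>a \<in> K\<close> by simp
  qed
  then show "h (x - y) = h (x' - y')" using xy by simp
qed

text \<open>The orbit of \<open>(0, 1)\<close> is the relation \<open>y - x \<in> K\<close>; with
  \<open>- 1 \<in> K\<close> it would be symmetric but not diagonal.\<close>

lemma minus_one_notin_if_antisymmetric:
  fixes K :: "'a::{finite,field} set"
  assumes "antisymmetric_config (cyclotomic_scheme K)" and K: "mult_subgroup K"
  shows "- 1 \<notin> K"
proof
  assume m: "- 1 \<in> K"
  have closed: "- a \<in> K" if "a \<in> K" for a
  proof -
    have "(- 1) * a \<in> K" using K m that unfolding mult_subgroup_def by blast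
    then show ?thesis by simp
  qed
  define s where "s = {(a * 0 + c, a * 1 + c) | a c. a \<in> K}"
  have "s \<in> snd (cyclotomic_scheme K)" unfolding snd_cyclotomic_scheme s_def by blast
  have s_iff: "(x, y) \<in> s \<longleftrightarrow> y - x \<in> K" for x y
    unfolding s_def by (auto intro: exI[of _ "y - x"])
  have "converse s = s"
    using closed by (auto simp: s_iff) (metis minus_diff_eq)+
  then have "s \<subseteq> Id_on UNIV"
    using assms(1) \<open>s \<in> snd (cyclotomic_scheme K)\<close> fst_cyclotomic_scheme
    unfolding antisymmetric_config_def by metis
  moreover have "1 \<in> K" using K unfolding mult_subgroup_def by blast
  then have "(0, 1) \<in> s" unfolding s_iff by simp
  ultimately show False by auto
qed

text \<open>For \<open>a \<in> K\<close> the power \<open>a ^ ((q - 1) / 2)\<close> is a square root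
  of 1 inside \<open>K\<close>, hence 1 because \<open>- 1 \<notin> K\<close>. So the quadratic
  character of differences is invariant under the affine group.\<close>

lemma fission_of_antisymmetric_cyclotomic:
  fixes K :: "'a::{finite,field} set"
  assumes K: "mult_subgroup K" and minus: "- 1 \<notin> K" and Y: "is_fission Y (cyclotomic_scheme K)"
  shows "\<exists>p d e k. paley_fission Y p d e k"
proof -
  let ?n = "(CARD('a) - 1) div 2"
  obtain d where d: "CARD('a) = CHAR('a) ^ d" using card_finite_field_prime_power by blast
  have one: "1 \<in> K" and mult: "\<And>x y. x \<in> K \<Longrightarrow> y \<in> K \<Longrightarrow> x * y \<in> K" and nz: "0 \<notin> K"
    using K unfolding mult_subgroup_def by blast+
  have odd: "(2::'a) \<noteq> 0"
  proof
    assume "(2::'a) = 0"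
    then have "1 + 1 = (0::'a)" by simp
    then have "- 1 = (1::'a)" by (metis add_eq_0_iff)
    with one minus show False by metis
  qed
  have coh: "coherent_config Y" and fstY: "fst Y = UNIV"
    using Y fst_cyclotomic_scheme unfolding is_fission_def by auto
  interpret coherent_on_UNIV Y by unfold_locales (fact coh fstY)+
  have "even (CARD('a) - 1)"
  proof (rule ccontr)
    assume "odd (CARD('a) - 1)"
    then have "(- 1 :: 'a) ^ (CARD('a) - 1) = - 1" by simp
    then have "- 1 = (1::'a)" using finite_field_power_card_minus_1[of "- 1 :: 'a"] by simp
    with one minus show False by metis
  qed
  then have n: "?n * 2 = CARD('a) - 1" by simp
  have "a ^ ?n = 1" if "a \<in> K" for a
  proof -
    have pow: "a ^ i \<in> K" for i by (induction i) (use one mult that in auto)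
    have "(a ^ ?n)\<^sup>2 = 1"
      unfolding power_mult[symmetric] n using finite_field_power_card_minus_1[of a] nz that by blast
    then have "a ^ ?n = 1 \<or> a ^ ?n = - 1" by (simp add: power2_eq_1_iff)
    then show ?thesis using pow[of ?n] minus by auto
  qed
  then have "class_fun (cyclotomic_scheme K) (\<lambda>x y. (x - y) ^ ?n)"
    by (intro class_fun_cyclotomic) (simp add: power_mult_distrib)
  then have "class_fun Y (\<lambda>x y. (x - y) ^ ?n)"
    by (rule class_fun_fission[OF Y _ cyclotomic_scheme_cover[OF K] coh])
  then have "paley_fission Y CHAR('a) d (norm_exp CHAR('a) d) ((CHAR('a) - 1) div 2)"
    by unfold_locales (use odd d in auto)
  then show ?thesis by blast
qed

theorem theorem3p2:
  fixes K :: "'a::{finite,field} set"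
  assumes "mult_subgroup K"
    and "antisymmetric_config (cyclotomic_scheme K)"
  shows "gb (cyclotomic_scheme K) \<le> 1 \<and> b (cyclotomic_scheme K) \<le> 3"
proof -
  let ?X = "cyclotomic_scheme K"
  have minus: "- 1 \<notin> K" by (rule minus_one_notin_if_antisymmetric[OF assms(2,1)])
  have one: "1 \<in> K" and mult: "\<And>x y. x \<in> K \<Longrightarrow> y \<in> K \<Longrightarrow> x * y \<in> K" and nz: "0 \<notin> K"
    and inv: "\<And>x. x \<in> K \<Longrightarrow> inverse x \<in> K"
    using assms(1) unfolding mult_subgroup_def by blast+
  obtain g :: 'a where g: "g \<noteq> 0" "\<And>x. x \<noteq> 0 \<Longrightarrow> \<exists>i::nat. x = g ^ i"
    using finite_field_has_generator by blast
  \<comment> \<open>\<open>g\<close> and \<open>- g\<close> cannot both lie in \<open>K\<close>, as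
    their quotient is -1. The choice ensures \<open>- \<beta> \<notin> K\<close>, which keeps 0 out
    of \<open>T\<close> below.\<close>
  define \<beta> where "\<beta> = (if - g \<in> K then - g else g)"
  have \<beta>: "\<beta> \<noteq> 0" "\<beta> = g \<or> \<beta> = - g" "- \<beta> \<notin> K"
  proof -
    have "- 1 \<in> K" if "g \<in> K" "- g \<in> K"
      using mult[OF that(2) inv[OF that(1)]] g(1) by simp
    then show "- \<beta> \<notin> K" using minus by (auto simp: \<beta>_def)
  qed (use g in \<open>auto simp: \<beta>_def\<close>)
  have main: "relations Y = UNIV"
    if Y: "is_fission Y ?X" and fixed: "{0, 1, \<beta>} \<subseteq> coherent_on_UNIV.fixed Y" for Y
  proof -
    obtain p d e k where "paley_fission Y p d e k"
      using fission_of_antisymmetric_cyclotomic[OF assms(1) minus Y] by blast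
    then interpret paley_fission Y p d e k .
    have "g \<in> fixed"
      using fixed_reflect[of 0 \<beta>] fixed \<beta>(2) by auto
    then have "fixed = UNIV" using fixed_eq_UNIV[of g] fixed g(2) by auto
    then show ?thesis by (rule relations_UNIV_if_all_fixed)
  qed
  have coh: "coherent_on_UNIV Y" if "is_fission Y ?X" for Y
    using that fst_cyclotomic_scheme unfolding is_fission_def by unfold_locales auto

  have "base ?X {0, 1, \<beta>}"
    unfolding base_def
  proof (intro conjI generalized_baseI)
    fix Y assume Y: "is_fission Y ?X" "\<forall>\<Delta>\<in>(\<lambda>\<beta>. {\<beta>}) ` {0, 1, \<beta>}. union_of_fibers Y \<Delta>"
    interpret coherent_on_UNIV Y by (rule coh[OF Y(1)])
    have "z \<in> fixed" if "union_of_fibers Y {z}" for z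
      using definable_singleton[OF definable_union_of_fibers[OF that]] .
    then show "relations Y = UNIV" using Y by (intro main) auto
  qed (simp_all add: fst_cyclotomic_scheme)
  then have "b ?X \<le> card {0, 1, \<beta>}" unfolding b_def by (intro Least_le) blast
  also have "\<dots> \<le> 3" by (simp add: card_insert_if)
  finally have b3: "b ?X \<le> 3" .

  have "generalized_base ?X {{0, 1, \<beta>}}"
  proof (rule generalized_baseI)
    fix Y assume Y: "is_fission Y ?X" "\<forall>\<Delta>\<in>{{0, 1, \<beta>}}. union_of_fibers Y \<Delta>"
    interpret coherent_on_UNIV Y by (rule coh[OF Y(1)])
    let ?\<Delta> = "{0, 1, \<beta>}"
    \<comment> \<open>For every \<open>c\<close> the relation that \<open>x - y\<close> lies in the
      coset \<open>c * K\<close> is a union of basic relations of the scheme.\<close>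
    have color: "cf (\<lambda>x y. (x - y) / c \<in> K)" for c
    proof (rule class_fun_fission[OF Y(1) _ cyclotomic_scheme_cover[OF assms(1)] coherent])
      have "a * u / c \<in> K \<longleftrightarrow> u / c \<in> K" if "a \<in> K" for a u
      proof
        assume "a * u / c \<in> K"
        moreover have "a \<noteq> 0" using that nz by metis
        then have "inverse a * (a * u / c) = u / c" by simp
        ultimately show "u / c \<in> K" using mult[OF inv[OF that]] by metis
      next
        assume "u / c \<in> K"
        from mult[OF that this] show "a * u / c \<in> K" by simp
      qed
      then show "class_fun ?X (\<lambda>x y. (x - y) / c \<in> K)"
        by (rule class_fun_cyclotomic)
    qed
    have delta: "definable ?\<Delta>" by (rule definable_union_of_fibers) (use Y(2) in simp)
    \<comment> \<open>With \<open>c = u - v\<close> the relation contains \<open>(u, v)\<close> but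
      not \<open>(v, u)\<close>, since -1 is not in \<open>K\<close>; so it separates the two
      points.\<close>
    have pair: "u \<in> fixed \<and> v \<in> fixed" if "definable {u, v}" for u v
    proof (cases "u = v")
      case False
      let ?S = "{x \<in> {u, v}. \<exists>y\<in>{u, v}. (x - y) / (u - v) \<in> K}"
      have "(v - u) / (u - v) = - 1" using False by (simp add: field_simps)
      then have S: "?S = {u}" using False one minus nz by auto
      have "definable {u}" using definable_domain[OF that color[of "u - v"]] unfolding S .
      moreover have "{u, v} - {u} = {v}" using False by auto
      ultimately show ?thesis using definable_singleton definable_diff[OF that] by metis
    qed (use that definable_singleton in simp)
    \<comment> \<open>1 lies in \<open>T\<close> because \<open>1 - 0 \<in> K\<close>, and 0 does
      not. So \<open>T\<close> and its complement in \<open>?\<Delta>\<close> have at most two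
      points each, and \<open>pair\<close> applies; \<open>\<beta> = 1\<close> is allowed.\<close>
    define T where "T = {u \<in> ?\<Delta>. \<exists>v\<in>?\<Delta>. (u - v) / 1 \<in> K}"
    have T: "definable T" unfolding T_def by (rule definable_domain[OF delta color])
    have T_mem: "T \<subseteq> ?\<Delta>" "0 \<notin> T" "1 \<in> T" unfolding T_def using nz minus \<beta>(3) one by auto
    have "?\<Delta> \<subseteq> fixed"
    proof (cases "\<beta> \<in> T")
      case True
      then have "T = {1, \<beta>}" "?\<Delta> - T = {0}" using T_mem by auto
      then show ?thesis using definable_singleton definable_diff[OF delta T] pair[of 1 \<beta>] T by simp
    next
      case False
      then have "T = {1}" "?\<Delta> - T = {0, \<beta>}" using T_mem by auto
      then show ?thesis using definable_singleton definable_diff[OF delta T] pair[of 0 \<beta>] T by simp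
    qed
    then show "relations Y = UNIV" by (rule main[OF Y(1)])
  qed (simp add: fst_cyclotomic_scheme)
  moreover have "card {{0, 1, \<beta>}} = 1" by simp
  ultimately have "gb ?X \<le> 1" unfolding gb_def by (intro Least_le) blast
  with b3 show ?thesis by blast
qed

end
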